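(* Let $\lambda\in(0,1)$ and, for each integer $n\ge 1$, let $B=b_\lambda^{n}$ where $b_\lambda(z)=\frac{z-\lambda}{1-\lambda z}$. Let $p\in(1,\infty]$. Then there exist constants $c,C>0$, depending only on $p$ and $\lambda$, such that for all integers $n\ge 1$ (for all integers $n\geq 2$ in the case $p=4$) $$c\,\Psi_p(n)\ \le\ \Vert b_\lambda^{n}\Vert_{l_p^A}\ \le\ C\,\Psi_p(n),$$ where $$\Psi_p(n)=\begin{cases} n^{\frac{2-p}{2p}} & \text{if } p\in(1,4),\\ \left(\frac{\log n}{n}\right)^{1/4} & \text{if } p=4,\\ n^{\frac{1-p}{3p}} & \text{if } p\in(4,\infty],\end{cases}$$ and for $p=\infty$ the exponent $\frac{1-p}{3p}$ is understood as $-\frac13$.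
   Context: For a function $B=\sum_{k\ge0}\widehat B(k)z^k$ holomorphic on the open unit disk, $\Vert B\Vert_{l_p^A}=\left(\sum_{k\ge 0}|\widehat B(k)|^p\right)^{1/p}$ for $1\le p<\infty$ and $\Vert B\Vert_{l_\infty^A}=\sup_{k\ge 0}|\widehat B(k)|$, i.e. the $l_p$-norm of the sequence of Taylor coefficients. *)

theory Defs
  imports "HOL-Complex_Analysis.Complex_Analysis"
begin

definition taylor_coeff :: "(complex \<Rightarrow> complex) \<Rightarrow> nat \<Rightarrow> complex" where
  "taylor_coeff f k = fps_nth (fps_expansion f 0) k"

text \<open>
  The norm takes values in \<^typ>\<open>ennreal\<close>, so that it is \<^term>\<open>\<infinity>\<close> when the coefficient sequence is
  not in the sequence space (a real-valued series or supremum would be an arbitrary number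
  there). The inner case distinction is needed because \<^term>\<open>enn2real \<infinity> = 0\<close> and
  there is no \<^const>\<open>powr\<close> on \<^typ>\<open>ennreal\<close>. Only exponents \<open>p \<ge> 1\<close> are meaningful.
\<close>

definition lpA_norm :: "ennreal \<Rightarrow> (complex \<Rightarrow> complex) \<Rightarrow> ennreal" where
  "lpA_norm p f =
     (if p = \<infinity> then (SUP k. ennreal (cmod (taylor_coeff f k)))
      else let S = (\<Sum>k. ennreal (cmod (taylor_coeff f k) powr enn2real p))
           in if S = \<infinity> then \<infinity> else ennreal (enn2real S powr (1 / enn2real p)))"

definition blaschke :: "real \<Rightarrow> complex \<Rightarrow> complex" where
  "blaschke lam z = (z - of_real lam) / (1 - of_real lam * z)"

definition Psi :: "ennreal \<Rightarrow> nat \<Rightarrow> real" where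
  "Psi p n =
     (if p < 4 then real n powr ((2 - enn2real p) / (2 * enn2real p))
      else if p = 4 then (ln (real n) / real n) powr (1/4)
      else if p < \<infinity> then real n powr ((1 - enn2real p) / (3 * enn2real p))
      else real n powr (-1/3))"

end

theory Submission
  imports Defs
begin

text \<open>
  On the unit circle the Blaschke factor is cis (ang t), where ang is odd and its derivative is the
  Poisson kernel, which decreases on [0, pi] from be = (1+lam)/(1-lam) to al = (1-lam)/(1+lam).
  So the k-th coefficient of the n-th power is 1/pi times the integral over [0, pi] of
  cos (n * ang t - k * t), whose phase has a stationary point iff al * n <= k <= be * n, a
  degenerate one at the two ends of this range. Van der Corput's first and second derivative tests bound
  the coefficient by a multiple of (n * (n powr (1/3) + g)) powr (-1/4), where g is the distance of k to the
  two ends, and by a multiple of 1/k for k > 2 * be * n; summing p-th powers gives the upper bound.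

  For the lower bound, let I k x be the same integral over [0, x]. As the power has modulus 1 on
  the circle, its Fourier series gives that the sum over k of the k-th coefficient times
  I k x equals x. With x of order sqrt (m / n) the sum is carried by the
  indices at distance about m from be * n, which bounds their total mass from below; Jensen's
  inequality turns this into a bound for p-th powers.
\<close>

text \<open>An index at distance g inside the stationary range has its stationary point at distance
  of order sqrt (g / n) from 0 or pi, where the second derivative of the phase has order sqrt (n *
  g); this is the source of the size (n * g) powr (-1/4). It saturates once that distance falls to n
  powr (-1/3), that is g to n powr (1/3), hence the sum n powr (1/3) + g. The q-th powers then
  behave like a sum of g powr (-q/4), whose exponent passes 1 at q = 4: this is the origin of the
  three cases of \<open>Psi\<close>. The obstacle to the lower bound is that the leading term of a
  coefficient oscillates, so a single coefficient may be far below its upper bound. The duality sum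
  avoids pointwise lower bounds: upper bounds for both factors show that it cannot live outside one
  annulus. This works for large n; for the remaining n the zeroth coefficient, of modulus lam ^ n,
  suffices.\<close>

section \<open>Oscillatory integrals with concave phase\<close>

text \<open>Integration by parts: \<open>g\<close> is the derivative of sin f / f'. The sign of f''
  is constant, so the remainder is dominated by the integral of the derivative of 1 / f' and
  telescopes; each of the resulting four boundary terms is at most 1 / \<mu>.\<close>

lemma van_der_corput_first:
  fixes f f' f'' :: "real \<Rightarrow> real"
  assumes "a \<le> b" "0 < \<mu>"
    and f: "\<And>t. t \<in> {a..b} \<Longrightarrow> (f has_real_derivative f' t) (at t)"
    and f': "\<And>t. t \<in> {a..b} \<Longrightarrow> (f' has_real_derivative f'' t) (at t)"
    and concave: "\<And>t. t \<in> {a..b} \<Longrightarrow> f'' t \<le> 0"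
    and large: "\<And>t. t \<in> {a..b} \<Longrightarrow> \<mu> \<le> \<bar>f' t\<bar>"
  shows "\<bar>integral {a..b} (\<lambda>t. cos (f t))\<bar> \<le> 4 / \<mu>"
proof -
  have nz: "f' t \<noteq> 0" if "t \<in> {a..b}" for t
    using large[OF that] \<open>0 < \<mu>\<close> by auto
  have inv: "\<bar>1 / f' t\<bar> \<le> 1 / \<mu>" if "t \<in> {a..b}" for t
    using large[OF that] \<open>0 < \<mu>\<close> by (simp add: abs_divide frac_le)
  define g where "g t = cos (f t) - sin (f t) * f'' t / (f' t)\<^sup>2" for t
  have 1: "(g has_integral (sin (f b) / f' b - sin (f a) / f' a)) {a..b}"
  proof (rule fundamental_theorem_of_calculus[OF \<open>a \<le> b\<close>])
    fix t assume t: "t \<in> {a..b}"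
    have "((\<lambda>t. sin (f t) / f' t) has_real_derivative g t) (at t)"
      unfolding g_def using nz[OF t]
      by (auto intro!: derivative_eq_intros f[OF t] f'[OF t] simp: field_simps power2_eq_square)
    then show "((\<lambda>t. sin (f t) / f' t) has_vector_derivative g t) (at t within {a..b})"
      by (simp add: has_real_derivative_iff_has_vector_derivative has_vector_derivative_at_within)
  qed
  have 2: "((\<lambda>t. - f'' t / (f' t)\<^sup>2) has_integral (1 / f' b - 1 / f' a)) {a..b}"
  proof (rule fundamental_theorem_of_calculus[OF \<open>a \<le> b\<close>])
    fix t assume t: "t \<in> {a..b}"
    have "((\<lambda>t. 1 / f' t) has_real_derivative - f'' t / (f' t)\<^sup>2) (at t)"
      using nz[OF t] by (auto intro!: derivative_eq_intros f'[OF t] simp: field_simps power2_eq_square)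
    then show "((\<lambda>t. 1 / f' t) has_vector_derivative - f'' t / (f' t)\<^sup>2) (at t within {a..b})"
      by (simp add: has_real_derivative_iff_has_vector_derivative has_vector_derivative_at_within)
  qed
  have cont: "continuous_on {a..b} (\<lambda>t. cos (f t))"
    by (intro continuous_intros continuous_at_imp_continuous_on ballI)
      (use f DERIV_isCont in blast)
  then have 3: "((\<lambda>t. cos (f t)) has_integral integral {a..b} (\<lambda>t. cos (f t))) {a..b}"
    by (intro integrable_integral integrable_continuous_real)
  define r where "r = integral {a..b} (\<lambda>t. cos (f t)) - (sin (f b) / f' b - sin (f a) / f' a)"
  have 4: "((\<lambda>t. cos (f t) - g t) has_integral r) {a..b}"
    unfolding r_def by (rule has_integral_diff[OF 3 1])
  have "norm (integral {a..b} (\<lambda>t. cos (f t) - g t)) \<le> integral {a..b} (\<lambda>t. - f'' t / (f' t)\<^sup>2)"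
  proof (rule integral_norm_bound_integral)
    fix t assume t: "t \<in> {a..b}"
    have "\<bar>sin (f t) * f'' t\<bar> \<le> \<bar>f'' t\<bar>"
      by (simp add: abs_mult mult_left_le_one_le)
    then show "norm (cos (f t) - g t) \<le> - f'' t / (f' t)\<^sup>2"
      using concave[of t] t divide_right_mono[of "\<bar>sin (f t) * f'' t\<bar>" "- f'' t" "(f' t)\<^sup>2"]
      by (simp add: g_def abs_divide)
  qed (use 4 2 in blast)+
  then have "\<bar>r\<bar> \<le> 1 / f' b - 1 / f' a"
    by (simp only: integral_unique[OF 4] integral_unique[OF 2] real_norm_def)
  moreover have sb: "\<bar>sin (f t) / f' t\<bar> \<le> 1 / \<mu>" if "t \<in> {a..b}" for t
  proof -
    have "\<bar>sin (f t) / f' t\<bar> \<le> \<bar>1 / f' t\<bar>" 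
      by (simp add: abs_divide divide_right_mono)
    then show ?thesis using inv[OF that] by linarith
  qed
  ultimately have "\<bar>integral {a..b} (\<lambda>t. cos (f t))\<bar> \<le> 4 * (1 / \<mu>)"
    using sb[of a] sb[of b] inv[of a] inv[of b] \<open>a \<le> b\<close> unfolding r_def atLeastAtMost_iff by linarith
  then show ?thesis by simp
qed

text \<open>f' falls at rate at least \<rho>, so at distance h = 1 / sqrt \<rho> from a zero its
  modulus is at least sqrt \<rho>. On each side of the zero the trivial bound gives h and the first
  test 4 * h; if f' keeps its sign, one side is the whole interval.\<close>

lemma van_der_corput_second:
  fixes f f' f'' :: "real \<Rightarrow> real"
  assumes "a \<le> b" "0 < \<rho>"
    and f: "\<And>t. t \<in> {a..b} \<Longrightarrow> (f has_real_derivative f' t) (at t)"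
    and f': "\<And>t. t \<in> {a..b} \<Longrightarrow> (f' has_real_derivative f'' t) (at t)"
    and concave: "\<And>t. t \<in> {a..b} \<Longrightarrow> f'' t \<le> - \<rho>"
  shows "\<bar>integral {a..b} (\<lambda>t. cos (f t))\<bar> \<le> 10 / sqrt \<rho>"
proof -
  define h where "h = 1 / sqrt \<rho>"
  have h: "h > 0" "\<rho> * h = sqrt \<rho>" using \<open>0 < \<rho>\<close> by (auto simp: h_def real_div_sqrt)
  let ?I = "\<lambda>x y. integral {x..y} (\<lambda>t. cos (f t))"
  have cont: "continuous_on {a..b} (\<lambda>t. cos (f t))"
    by (intro continuous_intros continuous_at_imp_continuous_on ballI)
      (use f DERIV_isCont in blast)
  have int: "(\<lambda>t. cos (f t)) integrable_on {x..y}" if "a \<le> x" "y \<le> b" for x y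
    by (rule integrable_continuous_real[OF continuous_on_subset[OF cont]]) (use that in auto)
  have split: "?I x y = ?I x z + ?I z y" if "a \<le> x" "x \<le> z" "z \<le> y" "y \<le> b" for x y z
    using Henstock_Kurzweil_Integration.integral_combine[OF that(2,3) int[OF that(1,4)]] by simp
  have triv: "\<bar>?I x y\<bar> \<le> y - x" if "a \<le> x" "x \<le> y" "y \<le> b" for x y
    using integral_bound[of x y "\<lambda>t. cos (f t)" 1] that continuous_on_subset[OF cont, of "{x..y}"] by auto
  have drop: "f' y \<le> f' x - \<rho> * (y - x)" if "a \<le> x" "x \<le> y" "y \<le> b" for x y
  proof -
    have "f' y + \<rho> * y \<le> f' x + \<rho> * x"
    proof (rule DERIV_nonpos_imp_nonincreasing[of x y "\<lambda>t. f' t + \<rho> * t"])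
      fix t assume t: "x \<le> t" "t \<le> y"
      then have "((\<lambda>t. f' t + \<rho> * t) has_real_derivative f'' t + \<rho>) (at t)"
        using that by (auto intro!: derivative_eq_intros f')
      moreover have "f'' t + \<rho> \<le> 0" using concave[of t] t that by auto
      ultimately show "\<exists>d. ((\<lambda>t. f' t + \<rho> * t) has_real_derivative d) (at t) \<and> d \<le> 0" by blast
    qed (rule that)
    then show ?thesis by (simp add: algebra_simps)
  qed
  have far: "\<bar>?I x y\<bar> \<le> 4 * h" if "a \<le> x" "x \<le> y" "y \<le> b" "f' x \<le> - sqrt \<rho> \<or> f' y \<ge> sqrt \<rho>" for x y
  proof -
    have big: "sqrt \<rho> \<le> \<bar>f' t\<bar>" if "t \<in> {x..y}" for t
    proof -
      have "f' t \<le> f' x" "f' y \<le> f' t"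
        using drop[of x t] drop[of t y] that \<open>a \<le> x\<close> \<open>y \<le> b\<close> \<open>0 < \<rho>\<close>
        by (auto intro: order_trans)
      then show ?thesis
        using \<open>f' x \<le> - sqrt \<rho> \<or> f' y \<ge> sqrt \<rho>\<close> by (elim disjE) (linarith)+
    qed
    have "\<bar>?I x y\<bar> \<le> 4 / sqrt \<rho>"
    proof (rule van_der_corput_first[where f' = f' and f'' = f''])
      show "f'' t \<le> 0" if "t \<in> {x..y}" for t
        using concave[of t] that \<open>0 < \<rho>\<close> \<open>a \<le> x\<close> \<open>y \<le> b\<close> by auto
    qed (use that big f f' \<open>0 < \<rho>\<close> in auto)
    then show ?thesis by (simp add: h_def)
  qed
  have right: "\<bar>?I x b\<bar> \<le> 5 * h" if "a \<le> x" "x \<le> b" "f' x \<le> 0" for x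
  proof (cases "b \<le> x + h")
    case True then show ?thesis using triv[of x b] that h by auto
  next
    case False
    have "f' (x + h) \<le> - sqrt \<rho>" using drop[of x "x + h"] that False h by auto
    then show ?thesis
      using triv[of x "x + h"] far[of "x + h" b] split[of x "x + h" b] that False h by auto
  qed
  have left: "\<bar>?I a y\<bar> \<le> 5 * h" if "a \<le> y" "y \<le> b" "0 \<le> f' y" for y
  proof (cases "y \<le> a + h")
    case True then show ?thesis using triv[of a y] that h by auto
  next
    case False
    have "sqrt \<rho> \<le> f' (y - h)" using drop[of "y - h" y] that False h by auto
    then show ?thesis
      using triv[of "y - h" y] far[of a "y - h"] split[of a "y - h" y] that False h by auto
  qed
  have "\<bar>?I a b\<bar> \<le> 10 * h"
  proof -
    consider "f' a \<le> 0" | "0 \<le> f' b" | "f' b \<le> 0" "0 \<le> f' a" by linarith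
    then show ?thesis
    proof cases
      case 1 then show ?thesis using right[of a] \<open>a \<le> b\<close> h by auto
    next
      case 2 then show ?thesis using left[of b] \<open>a \<le> b\<close> h by auto
    next
      case 3
      have "\<exists>x. a \<le> x \<and> x \<le> b \<and> f' x = 0"
        by (rule IVT2) (use 3 \<open>a \<le> b\<close> f' DERIV_isCont in auto)
      then obtain x where "a \<le> x" "x \<le> b" "f' x = 0" by auto
      then show ?thesis using right[of x] left[of x] split[of a x b] by auto
    qed
  qed
  then show ?thesis by (simp add: h_def)
qed

section \<open>Taylor coefficients as oscillatory integrals\<close>

lemma sums_integral_term_by_term:
  fixes a :: "nat \<Rightarrow> complex" and g :: "nat \<Rightarrow> real \<Rightarrow> real"
  assumes a: "summable (\<lambda>k. norm (a k))"
    and g: "\<And>k. continuous_on {0..x} (g k)" "\<And>k t. \<bar>g k t\<bar> \<le> 1"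
    and s: "\<And>t. t \<in> {0..x} \<Longrightarrow> (\<lambda>k. a k * of_real (g k t)) sums s t"
  shows "(\<lambda>k. a k * of_real (integral {0..x} (g k))) sums integral {0..x} s"
proof -
  have "uniform_limit {0..x} (\<lambda>N t. \<Sum>k<N. a k * of_real (g k t)) (\<lambda>t. \<Sum>k. a k * of_real (g k t)) sequentially"
    by (rule Weierstrass_m_test[where M = "\<lambda>k. norm (a k)"])
      (use a g(2) in \<open>auto simp: norm_mult mult_left_le\<close>)
  then obtain I J where IJ: "\<And>N. ((\<lambda>t. \<Sum>k<N. a k * of_real (g k t)) has_integral I N) {0..x}"
      "((\<lambda>t. \<Sum>k. a k * of_real (g k t)) has_integral J) {0..x}" "I \<longlonglongrightarrow> J"
    by (rule uniform_limit_integral) (auto intro!: continuous_intros g(1))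
  have "((\<lambda>t. \<Sum>k<N. a k * of_real (g k t)) has_integral (\<Sum>k<N. a k * of_real (integral {0..x} (g k)))) {0..x}" for N
    by (intro has_integral_sum finite_lessThan has_integral_mult_right has_integral_of_real
        integrable_integral integrable_continuous_real g(1))
  then have "I = (\<lambda>N. \<Sum>k<N. a k * of_real (integral {0..x} (g k)))"
    using IJ(1) has_integral_unique by blast
  moreover have "integral {0..x} s = integral {0..x} (\<lambda>t. \<Sum>k. a k * of_real (g k t))"
    by (rule integral_cong) (use s sums_unique in blast)
  ultimately show ?thesis
    using IJ(3) integral_unique[OF IJ(2)] by (simp add: sums_def)
qed

text \<open>1 + i u has argument arctan u, so its quotient by its conjugate has twice that argument;
  the product form avoids the division.\<close>

lemma cis_double_arctan: "cis (2 * arctan u) * (1 - \<i> * of_real u) = 1 + \<i> * of_real u"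
proof -
  have pos: "1 + u\<^sup>2 > 0" by (simp add: add_pos_nonneg)
  define r where "r = sqrt (1 + u\<^sup>2)"
  have r: "r > 0" "r\<^sup>2 = 1 + u\<^sup>2" using pos by (auto simp: r_def)
  have c: "cis (arctan u) * of_real r = 1 + \<i> * of_real u"
    using r(1) by (simp add: complex_eq_iff cos_arctan sin_arctan r_def[symmetric])
  have "(cis (arctan u))\<^sup>2 * (1 - \<i> * of_real u) * (of_real r)\<^sup>2 = (cis (arctan u) * of_real r)\<^sup>2 * (1 - \<i> * of_real u)"
    by (simp add: power_mult_distrib)
  also have "\<dots> = (1 + \<i> * of_real u) * ((1 + \<i> * of_real u) * (1 - \<i> * of_real u))"
    by (simp add: c power2_eq_square)
  also have "(1 + \<i> * of_real u) * (1 - \<i> * of_real u) = (of_real r)\<^sup>2"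
    by (simp add: complex_eq_iff power2_eq_square r(2)[unfolded power2_eq_square])
  finally show ?thesis
    using r(1) by (simp add: Complex.DeMoivre)
qed

locale blaschke_factor =
  fixes lam :: real
  assumes lam_pos: "0 < lam" and lam_less_1: "lam < 1"
begin

text \<open>With w = 1 - lam * cis t, the Blaschke factor at cis t is cis t * cnj w / w. As Re w >
  0, the arctan is a smooth argument of cnj w on the whole line, so no branch has to be
  tracked.\<close>

definition ang :: "real \<Rightarrow> real" where
  "ang t = t + 2 * arctan (lam * sin t / (1 - lam * cos t))"

definition poisson :: "real \<Rightarrow> real" where
  "poisson t = (1 - lam\<^sup>2) / (1 - 2 * lam * cos t + lam\<^sup>2)"

definition osc :: "nat \<Rightarrow> nat \<Rightarrow> real \<Rightarrow> real" where
  "osc n k x = integral {0..x} (\<lambda>t. cos (real n * ang t - real k * t))"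

abbreviation coef :: "nat \<Rightarrow> nat \<Rightarrow> complex" where
  "coef n k \<equiv> taylor_coeff (\<lambda>z. blaschke lam z ^ n) k"

lemma one_minus_pos: "1 - lam * cos t > 0"
proof -
  have "lam * cos t \<le> lam * 1" using lam_pos by (intro mult_left_mono) auto
  then show ?thesis using lam_less_1 by linarith
qed

lemma denom_bounds: "(1 - lam)\<^sup>2 \<le> 1 - 2 * lam * cos t + lam\<^sup>2" "1 - 2 * lam * cos t + lam\<^sup>2 \<le> (1 + lam)\<^sup>2"
proof -
  have "lam * cos t \<le> lam * 1" "lam * (-1) \<le> lam * cos t" using lam_pos by (intro mult_left_mono; simp)+
  then show "(1 - lam)\<^sup>2 \<le> 1 - 2 * lam * cos t + lam\<^sup>2" "1 - 2 * lam * cos t + lam\<^sup>2 \<le> (1 + lam)\<^sup>2"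
    by (auto simp: power2_eq_square algebra_simps)
qed

lemma denom_pos: "1 - 2 * lam * cos t + lam\<^sup>2 > 0"
  using denom_bounds(1)[of t] lam_less_1 by (smt (verit) zero_less_power2)

lemma ang_minus: "ang (- t) = - ang t"
  by (simp add: ang_def arctan_minus)

lemma blaschke_cis: "blaschke lam (cis t) = cis (ang t)"
proof -
  define u where "u = lam * sin t / (1 - lam * cos t)"
  have c: "1 - lam * cos t \<noteq> 0" using one_minus_pos[of t] by simp
  have 1: "(1 - \<i> * of_real u) * of_real (1 - lam * cos t) = 1 - of_real lam * cis t"
    using c by (simp add: u_def complex_eq_iff field_simps)
  have 2: "(1 + \<i> * of_real u) * of_real (1 - lam * cos t) = 1 - of_real lam * cis (- t)"
    using c by (simp add: u_def complex_eq_iff field_simps)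
  have 3: "1 - of_real lam * cis t \<noteq> 0"
    using c by (auto simp: complex_eq_iff)
  have "cis (2 * arctan u) * (1 - of_real lam * cis t) = 1 - of_real lam * cis (- t)"
    by (simp only: 1[symmetric] 2[symmetric] mult.assoc[symmetric] cis_double_arctan)
  moreover have "cis t * (1 - of_real lam * cis (- t)) = cis t - of_real lam"
    by (simp add: algebra_simps cis_mult)
  moreover have "cis (ang t) = cis t * cis (2 * arctan u)"
    by (simp add: ang_def u_def cis_mult)
  ultimately have "cis (ang t) * (1 - of_real lam * cis t) = cis t - of_real lam"
    by (simp add: mult.assoc)
  then show ?thesis using 3 by (simp add: blaschke_def field_simps)
qed

lemma ang_deriv: "(ang has_real_derivative poisson t) (at t)"
proof -
  define c s where "c = cos t" and "s = sin t"
  have sc: "s * s = 1 - c * c" using sin_squared_eq[of t] by (simp add: c_def s_def power2_eq_square)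
  have w: "1 - lam * c > 0" using one_minus_pos by (simp add: c_def)
  have D: "1 - 2 * lam * c + lam * lam > 0" using denom_pos[of t] by (simp add: c_def power2_eq_square)
  have A: "(ang has_real_derivative
      1 + 2 * (((lam * c) * (1 - lam * c) - (lam * s) * (lam * s)) / (1 - lam * c)\<^sup>2
              / (1 + (lam * s / (1 - lam * c))\<^sup>2))) (at t)"
    unfolding ang_def [abs_def] c_def s_def using one_minus_pos[of t]
    by (auto intro!: derivative_eq_intros simp: power2_eq_square divide_simps)
  have "(1 + (lam * s / (1 - lam * c))\<^sup>2) * (1 - lam * c)\<^sup>2 = (1 - lam * c)\<^sup>2 + (lam * s)\<^sup>2"
    using w by (simp add: field_simps)
  also have "\<dots> = 1 - 2 * lam * c + lam * lam"
    unfolding power_mult_distrib power2_eq_square[of s] sc by (simp add: power2_eq_square algebra_simps)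
  finally have B: "(1 - lam * c)\<^sup>2 * (1 + (lam * s / (1 - lam * c))\<^sup>2) = 1 - 2 * lam * c + lam * lam"
    by (simp add: mult.commute)
  have C: "(lam * c) * (1 - lam * c) - (lam * s) * (lam * s) = lam * c - lam * lam"
  proof -
    have "(lam * s) * (lam * s) = lam * lam * (s * s)" by simp
    then show ?thesis unfolding sc by (simp add: algebra_simps)
  qed
  have "1 + 2 * (((lam * c) * (1 - lam * c) - (lam * s) * (lam * s)) / (1 - lam * c)\<^sup>2
              / (1 + (lam * s / (1 - lam * c))\<^sup>2)) = poisson t"
    unfolding divide_divide_eq_left B C poisson_def c_def[symmetric] using D
    by (simp add: field_simps power2_eq_square)
  with A show ?thesis by simp
qed

lemma ang_continuous: "continuous_on S ang"
  using ang_deriv DERIV_isCont continuous_at_imp_continuous_on by blast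

lemma osc_continuous: "continuous_on S (\<lambda>t. cos (real n * ang t - real k * t))"
  by (intro continuous_intros ang_continuous)

text \<open>A pole can occur only at 1 / lam, outside the closed unit disk; hence the expansion is
  valid on the unit circle and converges absolutely there.\<close>

lemma blaschke_power_sums:
  assumes "cmod z < 1 / lam"
  shows "(\<lambda>k. coef n k * z ^ k) sums (blaschke lam z ^ n)"
proof -
  have nz: "1 - of_real lam * w \<noteq> 0" if "w \<in> ball 0 (1 / lam)" for w :: complex
  proof
    assume "1 - of_real lam * w = 0"
    then have "cmod (of_real lam * w) = 1" by (metis eq_iff_diff_eq_0 norm_one)
    then show False using that lam_pos by (simp add: norm_mult field_simps)
  qed
  have "(\<lambda>z. blaschke lam z ^ n) holomorphic_on ball 0 (1 / lam)"
    unfolding blaschke_def by (intro holomorphic_intros) (use nz in auto)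
  from holomorphic_power_series[OF this, of z] assms show ?thesis
    by (simp add: taylor_coeff_def fps_expansion_def)
qed

lemma coef_summable: "summable (\<lambda>k. cmod (coef n k))"
proof -
  define r where "r = (1 + 1 / lam) / 2"
  have r: "1 < r" "r < 1 / lam" using lam_pos lam_less_1 by (auto simp: r_def field_simps)
  have "summable (\<lambda>k. coef n k * of_real r ^ k)"
    using blaschke_power_sums[of "of_real r" n] r by (simp add: sums_summable)
  from powser_insidea[OF this, of 1] r show ?thesis by simp
qed

lemma cis_sum_minus: "cis y + cis (- y) = of_real (2 * cos y)"
  by (simp add: complex_eq_iff)

lemma mult_cis_power: "c * cis t ^ j * cis (- y) = c * cis (real j * t - y)"
  by (simp add: Complex.DeMoivre cis_mult mult.assoc)

lemma blaschke_cis_power: "blaschke lam (cis t) ^ n * cis (- y) = cis (real n * ang t - y)"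
  by (simp add: blaschke_cis Complex.DeMoivre cis_mult)

text \<open>After multiplication by cis (- k * t) the expansions at t and - t are averaged: as
  \<open>ang\<close> is odd, their values are conjugate and only cosines remain.\<close>

lemma coef_fourier:
  "(\<lambda>j. coef n j * of_real (cos ((real j - real k) * t))) sums of_real (cos (real n * ang t - real k * t))"
proof -
  have *: "(\<lambda>j. coef n j * cis ((real j - real k) * t)) sums cis (real n * ang t - real k * t)" for t
  proof -
    have "(\<lambda>j. coef n j * cis t ^ j) sums (blaschke lam (cis t) ^ n)"
      by (rule blaschke_power_sums) (use lam_pos lam_less_1 in auto)
    from sums_mult2[OF this, of "cis (- (real k * t))"] show ?thesis
      by (simp only: mult_cis_power blaschke_cis_power left_diff_distrib)
  qed
  have "(\<lambda>j. (coef n j * cis ((real j - real k) * t) + coef n j * cis ((real j - real k) * (- t))) / 2) sums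
        ((cis (real n * ang t - real k * t) + cis (real n * ang (- t) - real k * (- t))) / 2)"
    by (intro sums_divide sums_add *)
  also have "cis (real n * ang t - real k * t) + cis (real n * ang (- t) - real k * (- t)) =
     of_real (2 * cos (real n * ang t - real k * t))"
    using cis_sum_minus[of "real n * ang t - real k * t"] by (simp add: ang_minus)
  also have "(\<lambda>j. (coef n j * cis ((real j - real k) * t) + coef n j * cis ((real j - real k) * (- t))) / 2) =
      (\<lambda>j. coef n j * of_real (cos ((real j - real k) * t)))"
    using cis_sum_minus[of "(real j - real k) * t" for j] by (simp flip: distrib_left)
  finally show ?thesis by simp
qed

lemma integral_cos_int: "integral {0..pi} (\<lambda>t. cos ((real j - real k) * t)) = (if j = k then pi else 0)"
proof (cases "j = k")
  case False
  define d where "d = real j - real k"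
  have d: "d \<noteq> 0" using False by (simp add: d_def)
  have "sin (d * pi) = 0"
    using sin_zero_iff_int2[of "d * pi"] by (auto simp: d_def intro!: exI[of _ "int j - int k"])
  moreover have "((\<lambda>t. cos (d * t)) has_integral (sin (d * pi) / d - sin (d * 0) / d)) {0..pi}"
  proof (rule fundamental_theorem_of_calculus)
    fix t
    have "((\<lambda>t. sin (d * t) / d) has_real_derivative cos (d * t)) (at t)"
      using d by (auto intro!: derivative_eq_intros)
    then show "((\<lambda>t. sin (d * t) / d) has_vector_derivative cos (d * t)) (at t within {0..pi})"
      by (simp add: has_real_derivative_iff_has_vector_derivative has_vector_derivative_at_within)
  qed simp
  ultimately show ?thesis using False by (simp add: d_def integral_unique)
qed simp

text \<open>Integrating the cosine expansion over [0, pi] isolates the term j = k. In particular the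
  coefficients are real.\<close>

lemma coef_eq_osc: "coef n k = of_real (osc n k pi / pi)"
proof -
  have "(\<lambda>j. coef n j * of_real (integral {0..pi} (\<lambda>t. cos ((real j - real k) * t)))) sums
      integral {0..pi} (\<lambda>t. of_real (cos (real n * ang t - real k * t)))"
    by (rule sums_integral_term_by_term) (auto intro!: coef_summable coef_fourier continuous_intros)
  also have "integral {0..pi} (\<lambda>t. of_real (cos (real n * ang t - real k * t))) = (of_real (osc n k pi) :: complex)"
    unfolding osc_def
    by (intro integral_unique has_integral_of_real integrable_integral integrable_continuous_real osc_continuous)
  finally have "(\<lambda>j. if j = k then coef n j * of_real pi else 0) sums of_real (osc n k pi)"
    by (simp add: integral_cos_int if_distrib cong: if_cong)
  moreover have "(\<lambda>j. if j = k then coef n j * of_real pi else 0) sums (coef n k * of_real pi)"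
    by (rule sums_If_finite_set'[of "\<lambda>j. 0" 0 "{k}", simplified, THEN sums_cong[THEN iffD1, rotated]]) auto
  ultimately have "coef n k * of_real pi = of_real (osc n k pi)"
    using sums_unique2 by blast
  then show ?thesis by (simp add: field_simps)
qed

text \<open>Multiplying the expansion on the circle by cis (- n * ang t) turns its value into 1;
  averaging over t and - t leaves the cosines of \<open>osc\<close>, and absolute summability
  permits integration over [0, x].\<close>

lemma sum_coef_osc: 
  assumes "0 \<le> x"
  shows "(\<lambda>k. (osc n k pi / pi) * osc n k x) sums x"
proof -
  have "(\<lambda>k. coef n k * of_real (osc n k x)) sums integral {0..x} (\<lambda>t. 1)"
    unfolding osc_def
  proof (rule sums_integral_term_by_term)
    fix t
    have *: "(\<lambda>j. coef n j * cis (real j * t - real n * ang t)) sums 1" for t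
    proof -
      have "(\<lambda>j. coef n j * cis t ^ j) sums (blaschke lam (cis t) ^ n)"
        by (rule blaschke_power_sums) (use lam_pos lam_less_1 in auto)
      from sums_mult2[OF this, of "cis (- (real n * ang t))"] show ?thesis
        by (simp only: mult_cis_power blaschke_cis_power) simp
    qed
    have "(\<lambda>j. (coef n j * cis (real j * t - real n * ang t) + 
                coef n j * cis (real j * (- t) - real n * ang (- t))) / 2) sums ((1 + 1) / 2)"
      by (intro sums_divide sums_add *)
    also have "(\<lambda>j. (coef n j * cis (real j * t - real n * ang t) + 
                coef n j * cis (real j * (- t) - real n * ang (- t))) / 2) = 
          (\<lambda>j. coef n j * of_real (cos (real n * ang t - real j * t)))"
      using cis_sum_minus[of "real n * ang t - real j * t" for j] by (simp add: ang_minus add.commute flip: distrib_left)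
    finally show "(\<lambda>j. coef n j * of_real (cos (real n * ang t - real j * t))) sums 1" by simp
  qed (auto intro!: coef_summable osc_continuous)
  then have "(\<lambda>k. complex_of_real (osc n k pi / pi * osc n k x)) sums of_real x"
    using assms by (simp add: coef_eq_osc scaleR_conv_of_real)
  then show ?thesis by (simp only: sums_of_real_iff)
qed

end

section \<open>Upper bounds for the coefficients\<close>

lemma one_minus_cos_le: "1 - cos t \<le> t\<^sup>2 / 2" for t :: real
proof -
  have "\<bar>sin (t / 2)\<bar>\<^sup>2 \<le> \<bar>t / 2\<bar>\<^sup>2"
    by (intro power_mono abs_sin_x_le_abs_x) auto
  then show ?thesis
    using cos_double_sin[of "t / 2"] by (simp add: power_divide)
qed

lemma sin_ge_half:
  fixes s :: real
  assumes "0 \<le> s" "s \<le> 1"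
  shows "s / 2 \<le> sin s"
proof -
  have "sin 0 - 0 / 2 \<le> sin s - s / 2"
  proof (rule DERIV_nonneg_imp_nondecreasing[OF assms(1), of "\<lambda>t. sin t - t / 2"])
    fix t :: real assume "0 \<le> t" "t \<le> s"
    then have "t\<^sup>2 \<le> 1" using assms by (simp add: power_le_one)
    then have "cos t - 1 / 2 \<ge> 0" using one_minus_cos_le[of t] by linarith
    moreover have "((\<lambda>t. sin t - t / 2) has_real_derivative cos t - 1 / 2) (at t)"
      by (auto intro!: derivative_eq_intros)
    ultimately show "\<exists>y. ((\<lambda>t. sin t - t / 2) has_real_derivative y) (at t) \<and> 0 \<le> y" by blast
  qed
  then show ?thesis by simp
qed

lemma sin_ge_half_middle:
  fixes s :: real
  assumes "0 \<le> s" "s \<le> 1" "s \<le> t" "t \<le> pi - s"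
  shows "s / 2 \<le> sin t"
proof -
  have s: "s \<le> pi / 2" using assms pi_ge_two by linarith
  have "sin s \<le> sin t"
  proof (cases "t \<le> pi / 2")
    case True then show ?thesis using assms by (intro sin_monotone_2pi_le) auto
  next
    case False
    then have "sin s \<le> sin (pi - t)" using assms by (intro sin_monotone_2pi_le) auto
    then show ?thesis by simp
  qed
  then show ?thesis using sin_ge_half[of s] assms by linarith
qed

context blaschke_factor begin

section \<open>The Poisson kernel: extreme values, flatness at the ends, slope in between\<close>

definition al :: real where "al = (1 - lam) / (1 + lam)"
definition be :: real where "be = (1 + lam) / (1 - lam)"
text \<open>\<open>curv\<close> comes from 1 - cos t \<le> t^2 / 2 with the denominators replaced by
  their minimum, and bounds the departure of the kernel from its extreme values;
  \<open>slope\<close> comes from the derivative with its denominator replaced by the maximum (1 +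
  lam)^4, and bounds the decrease from below.\<close>

definition curv :: real where "curv = lam * (1 - lam\<^sup>2) / (1 - lam) ^ 4"
definition slope :: real where "slope = 2 * lam * (1 - lam\<^sup>2) / (1 + lam) ^ 4"

lemma one_minus_sq_pos: "0 < 1 - lam\<^sup>2"
  using lam_pos lam_less_1 by (simp add: power_less_one_iff)

lemma constants_pos: "0 < al" "al < 1" "1 < be" "0 < curv" "0 < slope"
  using lam_pos lam_less_1 one_minus_sq_pos by (auto simp: al_def be_def curv_def slope_def)

lemma one_minus_sq: "1 - lam\<^sup>2 = (1 + lam) * (1 - lam)"
  by (simp add: power2_eq_square algebra_simps)

lemma diff_frac_same_numerator: "b \<noteq> 0 \<Longrightarrow> d \<noteq> 0 \<Longrightarrow> a / b - a / d = a * (d - b) / (b * d)"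
  for a b d :: real
  by (simp add: field_simps)

lemma poisson_0_diff: "be - poisson t = 2 * lam * (1 - lam\<^sup>2) * (1 - cos t) / ((1 - lam)\<^sup>2 * (1 - 2 * lam * cos t + lam\<^sup>2))"
proof -
  have "be = (1 - lam\<^sup>2) / (1 - lam)\<^sup>2"
    unfolding be_def one_minus_sq using lam_less_1 by (simp add: power2_eq_square)
  then have "be - poisson t = (1 - lam\<^sup>2) * ((1 - 2 * lam * cos t + lam\<^sup>2) - (1 - lam)\<^sup>2) /
     ((1 - lam)\<^sup>2 * (1 - 2 * lam * cos t + lam\<^sup>2))"
    using lam_less_1 denom_pos[of t] diff_frac_same_numerator[of "(1 - lam)\<^sup>2" "1 - 2 * lam * cos t + lam\<^sup>2" "1 - lam\<^sup>2"]
    by (simp add: poisson_def)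
  also have "(1 - 2 * lam * cos t + lam\<^sup>2) - (1 - lam)\<^sup>2 = 2 * lam * (1 - cos t)"
    by (simp add: power2_eq_square algebra_simps)
  finally show ?thesis by (simp only: mult_ac)
qed

lemma poisson_pi_diff: "poisson t - al = 2 * lam * (1 - lam\<^sup>2) * (1 + cos t) / ((1 + lam)\<^sup>2 * (1 - 2 * lam * cos t + lam\<^sup>2))"
proof -
  have "al = (1 - lam\<^sup>2) / (1 + lam)\<^sup>2"
    unfolding al_def one_minus_sq using lam_pos by (simp add: power2_eq_square)
  then have "poisson t - al = (1 - lam\<^sup>2) * ((1 + lam)\<^sup>2 - (1 - 2 * lam * cos t + lam\<^sup>2)) /
     ((1 + lam)\<^sup>2 * (1 - 2 * lam * cos t + lam\<^sup>2))"
    using lam_pos denom_pos[of t] diff_frac_same_numerator[of "1 - 2 * lam * cos t + lam\<^sup>2" "(1 + lam)\<^sup>2" "1 - lam\<^sup>2"]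
    by (simp add: poisson_def mult.commute)
  also have "(1 + lam)\<^sup>2 - (1 - 2 * lam * cos t + lam\<^sup>2) = 2 * lam * (1 + cos t)"
    by (simp add: power2_eq_square algebra_simps)
  finally show ?thesis by (simp only: mult_ac)
qed

lemma poisson_le_be: "poisson t \<le> be"
proof -
  have "0 \<le> be - poisson t"
    unfolding poisson_0_diff using lam_pos one_minus_sq_pos denom_pos[of t]
    by (intro divide_nonneg_nonneg mult_nonneg_nonneg) auto
  then show ?thesis by simp
qed

lemma al_le_poisson: "al \<le> poisson t"
proof -
  have "0 \<le> poisson t - al"
    unfolding poisson_pi_diff using lam_pos one_minus_sq_pos denom_pos[of t] cos_ge_minus_one[of t]
    by (intro divide_nonneg_nonneg mult_nonneg_nonneg) (auto simp del: cos_ge_minus_one)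
  then show ?thesis by simp
qed

lemma poisson_near_0: "be - poisson t \<le> curv * t\<^sup>2"
proof -
  have "be - poisson t \<le> 2 * lam * (1 - lam\<^sup>2) * (t\<^sup>2 / 2) / ((1 - lam)\<^sup>2 * (1 - lam)\<^sup>2)"
    unfolding poisson_0_diff using lam_pos one_minus_sq_pos denom_bounds[of t] lam_less_1
    by (intro frac_le mult_left_mono one_minus_cos_le mult_nonneg_nonneg mult_pos_pos) auto
  also have "\<dots> = curv * t\<^sup>2" by (simp add: curv_def flip: power_add)
  finally show ?thesis .
qed

lemma poisson_near_pi: "poisson t - al \<le> curv * (pi - t)\<^sup>2"
proof -
  have c: "1 + cos t \<le> (pi - t)\<^sup>2 / 2" using one_minus_cos_le[of "pi - t"] by simp
  \<comment> \<open>The factor (1 + lam)^2 is weakened to (1 - lam)^2 so that \<open>curv\<close>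
    serves both ends.\<close>
  have "(1 - lam)\<^sup>2 \<le> (1 + lam)\<^sup>2" using lam_pos lam_less_1 by (intro power_mono) auto
  then have "poisson t - al \<le> 2 * lam * (1 - lam\<^sup>2) * ((pi - t)\<^sup>2 / 2) / ((1 - lam)\<^sup>2 * (1 - lam)\<^sup>2)"
    unfolding poisson_pi_diff using lam_pos one_minus_sq_pos denom_bounds[of t] lam_less_1 c
    by (intro frac_le mult_left_mono mult_mono mult_nonneg_nonneg mult_pos_pos) auto
  also have "\<dots> = curv * (pi - t)\<^sup>2" by (simp add: curv_def flip: power_add)
  finally show ?thesis .
qed

definition poisson' :: "real \<Rightarrow> real" where
  "poisson' t = - (2 * lam * (1 - lam\<^sup>2) * sin t / (1 - 2 * lam * cos t + lam\<^sup>2)\<^sup>2)"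

lemma poisson_deriv: "(poisson has_real_derivative poisson' t) (at t)"
  unfolding poisson_def [abs_def] poisson'_def using denom_pos[of t]
  by (auto intro!: derivative_eq_intros simp: power2_eq_square divide_simps)

text \<open>Concavity of the phase, quantified: it degenerates only where sin t does, at 0 and
  pi.\<close>

lemma poisson'_le:
  assumes "0 \<le> t" "t \<le> pi"
  shows "poisson' t \<le> - (slope * sin t)"
proof -
  have "slope * sin t = 2 * lam * (1 - lam\<^sup>2) * sin t / ((1 + lam)\<^sup>2)\<^sup>2"
    by (simp add: slope_def)
  also have "\<dots> \<le> 2 * lam * (1 - lam\<^sup>2) * sin t / (1 - 2 * lam * cos t + lam\<^sup>2)\<^sup>2"
    using lam_pos one_minus_sq_pos denom_bounds[of t] denom_pos[of t] sin_ge_zero[OF assms]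
    by (intro divide_left_mono power_mono mult_nonneg_nonneg mult_pos_pos) auto
  finally show ?thesis by (simp add: poisson'_def)
qed

section \<open>Van der Corput bounds for full and partial integrals\<close>

abbreviation arc_osc :: "nat \<Rightarrow> nat \<Rightarrow> real \<Rightarrow> real \<Rightarrow> real" where
  "arc_osc n k a b \<equiv> integral {a..b} (\<lambda>t. cos (real n * ang t - real k * t))"

lemma phase_deriv:
  "((\<lambda>t. real n * ang t - real k * t) has_real_derivative real n * poisson t - real k) (at t)"
  "((\<lambda>t. real n * poisson t - real k) has_real_derivative real n * poisson' t) (at t)"
  by (auto intro!: derivative_eq_intros ang_deriv poisson_deriv)

lemma arc_osc_combine:
  assumes "a \<le> b" "b \<le> c"
  shows "arc_osc n k a c = arc_osc n k a b + arc_osc n k b c"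
  using Henstock_Kurzweil_Integration.integral_combine[OF assms integrable_continuous_real[OF osc_continuous]]
  by simp

lemma arc_osc_trivial: "a \<le> b \<Longrightarrow> \<bar>arc_osc n k a b\<bar> \<le> b - a"
  using integral_bound[of a b "\<lambda>t. cos (real n * ang t - real k * t)" 1] osc_continuous by auto

lemma arc_osc_first:
  assumes "0 \<le> a" "a \<le> b" "b \<le> pi" "0 < \<mu>"
    and "\<And>t. a \<le> t \<Longrightarrow> t \<le> b \<Longrightarrow> \<mu> \<le> \<bar>real n * poisson t - real k\<bar>"
  shows "\<bar>arc_osc n k a b\<bar> \<le> 4 / \<mu>"
proof (rule van_der_corput_first[OF assms(2,4) phase_deriv])
  fix t assume t: "t \<in> {a..b}"
  then have "poisson' t \<le> - (slope * sin t)" "0 \<le> slope * sin t"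
    using assms constants_pos by (auto intro!: poisson'_le sin_ge_zero mult_nonneg_nonneg)
  then show "real n * poisson' t \<le> 0" by (simp add: mult_nonneg_nonpos)
qed (use assms in auto)

lemma arc_osc_second:
  assumes "0 < s" "s \<le> 1" "s \<le> a" "a \<le> b" "b \<le> pi - s" "0 < n"
  shows "\<bar>arc_osc n k a b\<bar> \<le> 10 / sqrt (real n * (slope * (s / 2)))"
proof (rule van_der_corput_second[OF assms(4) _ phase_deriv])
  fix t assume t: "t \<in> {a..b}"
  have "poisson' t \<le> - (slope * sin t)"
    using assms t by (intro poisson'_le) auto
  moreover have "slope * (s / 2) \<le> slope * sin t"
    using assms t constants_pos by (intro mult_left_mono sin_ge_half_middle) auto
  ultimately have "real n * poisson' t \<le> real n * - (slope * (s / 2))"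
    by (intro mult_left_mono) auto
  then show "real n * poisson' t \<le> - (real n * (slope * (s / 2)))" by simp
qed (use assms constants_pos in auto)

lemma osc_three_pieces:
  assumes s: "0 < s" "s \<le> 1" and "0 < n" and x: "0 \<le> x" "x \<le> pi"
    and left: "\<And>y. 0 \<le> y \<Longrightarrow> y \<le> s \<Longrightarrow> \<bar>arc_osc n k 0 y\<bar> \<le> B"
    and right: "\<And>y. pi - s \<le> y \<Longrightarrow> y \<le> pi \<Longrightarrow> \<bar>arc_osc n k (pi - s) y\<bar> \<le> B"
  shows "\<bar>osc n k x\<bar> \<le> 2 * B + 10 / sqrt (real n * (slope * (s / 2)))"
proof -
  let ?M = "10 / sqrt (real n * (slope * (s / 2)))"
  have B: "0 \<le> B" using left[of 0] s by simp
  have M: "0 \<le> ?M" using s constants_pos by (intro divide_nonneg_nonneg) auto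
  have sp: "s \<le> pi - s" using s pi_ge_two by linarith
  consider "x \<le> s" | "s \<le> x" "x \<le> pi - s" | "pi - s \<le> x" by linarith
  then show ?thesis
  proof cases
    case 1 then show ?thesis using left[of x] B M x unfolding osc_def by linarith
  next
    case 2
    then show ?thesis
      using arc_osc_combine[of 0 s x n k] left[of s] arc_osc_second[of s s x n k] B M s \<open>0 < n\<close>
      unfolding osc_def by linarith
  next
    case 3
    then show ?thesis
      using arc_osc_combine[of 0 s x n k] arc_osc_combine[of s "pi - s" x n k] right[of x]
        left[of s] arc_osc_second[of s s "pi - s" n k] B M s \<open>0 < n\<close> x sp
      unfolding osc_def by linarith
  qed
qed

definition gap :: "nat \<Rightarrow> nat \<Rightarrow> real" where
  "gap n k = min \<bar>real k - al * real n\<bar> \<bar>real k - be * real n\<bar>"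

lemma osc_large_index:
  assumes "0 < n" "be * real n < real k" "0 \<le> x" "x \<le> pi"
  shows "\<bar>osc n k x\<bar> \<le> 4 / (real k - be * real n)"
  unfolding osc_def
proof (rule arc_osc_first)
  fix t
  have "real n * poisson t \<le> real n * be" using poisson_le_be by (intro mult_left_mono) auto
  then show "real k - be * real n \<le> \<bar>real n * poisson t - real k\<bar>" by (simp add: mult.commute)
qed (use assms in auto)

text \<open>s = n powr (-1/3) balances the trivial bound s on the end arcs against the order (n * s)
  powr (-1/2) of the middle.\<close>

lemma osc_bound_uniform:
  assumes "0 < n" "0 \<le> x" "x \<le> pi"
  shows "\<bar>osc n k x\<bar> \<le> (2 + 10 / sqrt (slope / 2)) * real n powr (- 1 / 3)"
proof -
  let ?s = "real n powr (- 1 / 3)"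
  have s: "0 < ?s" "?s \<le> 1" using assms by (auto simp: powr_minus_divide intro!: divide_le_eq_1_pos[THEN iffD2] ge_one_powr_ge_zero)
  have "\<bar>osc n k x\<bar> \<le> 2 * ?s + 10 / sqrt (real n * (slope * (?s / 2)))"
  proof (rule osc_three_pieces[OF s assms])
    show "\<bar>arc_osc n k 0 y\<bar> \<le> ?s" if "0 \<le> y" "y \<le> ?s" for y
      using arc_osc_trivial[of 0 y n k] that by linarith
    show "\<bar>arc_osc n k (pi - ?s) y\<bar> \<le> ?s" if "pi - ?s \<le> y" "y \<le> pi" for y
      using arc_osc_trivial[of "pi - ?s" y n k] that by linarith
  qed
  also have "sqrt (real n * (slope * (?s / 2))) = sqrt (slope / 2) * sqrt (real n * ?s)"
    by (simp add: mult_ac flip: real_sqrt_mult)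
  also have "real n * ?s = real n powr (2 / 3)"
    using assms by (simp add: powr_mult_base)
  also have "sqrt (real n powr (2 / 3)) = real n powr (1 / 3)"
    by (simp add: powr_powr flip: powr_half_sqrt)
  finally show ?thesis by (simp add: powr_minus_divide algebra_simps)
qed

text \<open>The end arcs are so short, s of order sqrt (gap / n), that n * poisson moves by at most
  half the gap on them; so the first test applies there. In the middle n * s is of order sqrt (n *
  gap).\<close>

lemma osc_bound_gap:
  assumes "0 < n" "0 \<le> x" "x \<le> pi" "real k \<le> 2 * be * real n" "0 < gap n k"
  shows "\<bar>osc n k x\<bar> \<le> 16 / gap n k +
      10 / (sqrt (slope / 2) * (1 / (2 * curv + be)) powr (1 / 4)) * (real n * gap n k) powr (- 1 / 4)"
proof -
  define m where "m = gap n k"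
  \<comment> \<open>e * curv \<le> 1/2 yields the half of the gap; e * be \<le> 1 yields s \<le> 1,
    since k \<le> 2 * be * n bounds the gap by be * n.\<close>
  define e where "e = 1 / (2 * curv + be)"
  have e: "0 < e" "e * curv \<le> 1 / 2" "e * be \<le> 1"
    using constants_pos by (auto simp: e_def field_simps)
  define s where "s = sqrt (e * m / real n)"
  have m: "0 < m" "m \<le> \<bar>real k - al * real n\<bar>" "m \<le> \<bar>real k - be * real n\<bar>" using assms by (auto simp: m_def gap_def)
  have mbe: "m \<le> be * real n" using m(3) assms constants_pos by auto
  have s2: "s\<^sup>2 = e * m / real n" using e m by (simp add: s_def)
  have s: "0 < s" using e m assms by (simp add: s_def)
  have "e * m \<le> e * (be * real n)" using mbe e by (intro mult_left_mono) auto
  also have "\<dots> \<le> 1 * real n" unfolding mult.assoc[symmetric] using e by (intro mult_right_mono) auto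
  finally have "s \<le> 1" using assms unfolding s_def by simp
  have flat: "real n * (curv * t\<^sup>2) \<le> m / 2" if "\<bar>t\<bar> \<le> s" for t
  proof -
    have "t\<^sup>2 \<le> s\<^sup>2" using that s by (simp add: abs_le_square_iff[symmetric])
    then have "real n * (curv * t\<^sup>2) \<le> real n * (curv * s\<^sup>2)"
      using constants_pos by (intro mult_left_mono) auto
    also have "\<dots> = (e * curv) * m" using assms by (simp add: s2)
    also have "\<dots> \<le> 1 / 2 * m" using e m by (intro mult_right_mono) auto
    finally show ?thesis by simp
  qed
  have "\<bar>osc n k x\<bar> \<le> 2 * (8 / m) + 10 / sqrt (real n * (slope * (s / 2)))"
  proof (rule osc_three_pieces[OF s \<open>s \<le> 1\<close> assms(1-3)])
    fix y assume y: "0 \<le> y" "y \<le> s"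
    have "\<bar>arc_osc n k 0 y\<bar> \<le> 4 / (m / 2)"
    proof (rule arc_osc_first)
      fix t assume t: "0 \<le> t" "t \<le> y"
      have "real n * (be - poisson t) \<le> real n * (curv * t\<^sup>2)"
        by (intro mult_left_mono poisson_near_0) auto
      also have "\<dots> \<le> m / 2" using flat t y by auto
      finally have 1: "be * real n - real n * poisson t \<le> m / 2" by (simp add: algebra_simps)
      have "real n * poisson t \<le> real n * be" using poisson_le_be by (intro mult_left_mono) auto
      then show "m / 2 \<le> \<bar>real n * poisson t - real k\<bar>" using 1 m(1,3) mult.commute[of "real n" be] by linarith
    qed (use y m \<open>s \<le> 1\<close> pi_ge_two in auto)
    then show "\<bar>arc_osc n k 0 y\<bar> \<le> 8 / m" by simp
  next
    fix y assume y: "pi - s \<le> y" "y \<le> pi"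
    have "\<bar>arc_osc n k (pi - s) y\<bar> \<le> 4 / (m / 2)"
    proof (rule arc_osc_first)
      fix t assume t: "pi - s \<le> t" "t \<le> y"
      have "real n * (poisson t - al) \<le> real n * (curv * (pi - t)\<^sup>2)"
        by (intro mult_left_mono poisson_near_pi) auto
      also have "\<dots> \<le> m / 2" using flat t y by auto
      finally have 1: "real n * poisson t - al * real n \<le> m / 2" by (simp add: algebra_simps)
      have "real n * al \<le> real n * poisson t" using al_le_poisson by (intro mult_left_mono) auto
      then show "m / 2 \<le> \<bar>real n * poisson t - real k\<bar>" using 1 m(1,2) mult.commute[of "real n" al] by linarith
    qed (use y m \<open>s \<le> 1\<close> pi_ge_two in auto)
    then show "\<bar>arc_osc n k (pi - s) y\<bar> \<le> 8 / m" by simp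
  qed
  also have "real n * (slope * (s / 2)) = slope / 2 * (real n * s)" by simp
  also have "real n * s = sqrt (e * (real n * m))"
    using assms m e by (simp add: s_def real_sqrt_divide real_sqrt_mult field_simps)
  also have "sqrt (slope / 2 * sqrt (e * (real n * m))) = sqrt (slope / 2) * (e powr (1 / 4) * (real n * m) powr (1 / 4))"
  proof -
    have "sqrt (sqrt (e * (real n * m))) = (e * (real n * m)) powr (1 / 4)"
      using e m assms by (simp add: powr_powr powr_half_sqrt[symmetric])
    also have "\<dots> = e powr (1 / 4) * (real n * m) powr (1 / 4)"
      by (rule powr_mult)
    finally show ?thesis by (simp only: real_sqrt_mult[of "slope / 2"])
  qed
  finally show ?thesis by (simp add: m_def e_def powr_minus_divide)
qed

text \<open>The two preceding bounds meet at a gap of n powr (1/3); adding this to the gap merges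
  them into one expression valid for every index.\<close>

lemma osc_bound:
  obtains C where "0 < C"
    and "\<And>n k x. 0 < n \<Longrightarrow> 0 \<le> x \<Longrightarrow> x \<le> pi \<Longrightarrow>
           \<bar>osc n k x\<bar> \<le> C * (real n * (real n powr (1 / 3) + gap n k)) powr (- 1 / 4)"
proof -
  define C1 where "C1 = 2 + 10 / sqrt (slope / 2)"
  define C2 where "C2 = 10 / (sqrt (slope / 2) * (1 / (2 * curv + be)) powr (1 / 4))"
  define C where "C = 2 * C1 + 2 * (16 + C2)"
  have C12: "0 < C1" "0 \<le> C2" using constants_pos by (auto simp: C1_def C2_def intro!: add_pos_nonneg)
  show thesis
  proof
    show "0 < C" using C12 by (simp add: C_def)
    fix n k :: nat and x :: real
    assume n: "0 < n" and x: "0 \<le> x" "x \<le> pi"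
    define L where "L = real n powr (1 / 3)"
    define m where "m = gap n k"
    define W where "W = (real n * (L + m)) powr (- 1 / 4)"
    have L: "1 \<le> L" using n by (auto simp: L_def intro!: ge_one_powr_ge_zero)
    have L3: "L ^ 3 = real n" using n by (simp add: L_def powr_power)
    have m: "0 \<le> m" by (simp add: m_def gap_def)
    have W: "0 < W" using n L m by (auto simp: W_def)
    \<comment> \<open>Passing from y to L + m \<le> 2 * y costs a factor 2 powr (1/4), rounded up to
      2.\<close>
    have W_ge: "(real n * y) powr (- 1 / 4) \<le> 2 * W" if "0 < y" "L + m \<le> 2 * y" for y
    proof -
      have "2 powr (- 1 / 4) * (real n * y) powr (- 1 / 4) = (real n * (2 * y)) powr (- 1 / 4)"
        using that n by (subst powr_mult[symmetric]) (auto simp: mult_ac)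
      also have "\<dots> \<le> W"
        unfolding W_def using that n L m by (intro powr_mono2') auto
      finally have "2 * (2 powr (- 1 / 4) * (real n * y) powr (- 1 / 4)) \<le> 2 * W" by simp
      moreover have "(2::real) powr (- 1) \<le> 2 powr (- 1 / 4)" by (intro powr_mono) auto
      then have "1 * (real n * y) powr (- 1 / 4) \<le> 2 * 2 powr (- 1 / 4) * (real n * y) powr (- 1 / 4)"
        by (intro mult_right_mono) (auto simp: powr_minus)
      ultimately show ?thesis by simp
    qed
    have "\<bar>osc n k x\<bar> \<le> C * W"
    proof (cases "m < L")
      case True
      have "\<bar>osc n k x\<bar> \<le> C1 * real n powr (- 1 / 3)"
        unfolding C1_def by (rule osc_bound_uniform[OF n x])
      also have "real n powr (- 1 / 3) = (real n * L) powr (- 1 / 4)"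
        using n by (simp add: L_def powr_mult_base powr_powr)
      also have "C1 * \<dots> \<le> C1 * (2 * W)"
        using True L C12 by (intro mult_left_mono W_ge) auto
      also have "\<dots> \<le> C * W"
        using C12 W by (simp add: C_def algebra_simps)
      finally show ?thesis .
    next
      case False
      then have mpos: "0 < m" "L \<le> m" using L by auto
      \<comment> \<open>This is what lets the end-arc contribution 1 / m be absorbed by (n * m) powr
        (- 1/4).\<close>
      have nm: "real n \<le> m ^ 3" using power_mono[OF mpos(2), of 3] L L3 by simp
      have "real n * m \<le> m ^ 3 * m" using nm mpos by (intro mult_right_mono) auto
      also have "\<dots> = m powr 4" using mpos by (simp add: power4_eq_xxxx power3_eq_cube)
      finally have "(m powr 4) powr (- 1 / 4) \<le> (real n * m) powr (- 1 / 4)"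
        using mpos n by (intro powr_mono2') auto
      moreover have "(m powr 4) powr (- 1 / 4) = 1 / m"
        by (subst powr_powr) (use mpos in \<open>simp add: powr_minus_divide\<close>)
      ultimately have 1: "1 / m \<le> (real n * m) powr (- 1 / 4)" by simp
      have 2: "(real n * m) powr (- 1 / 4) \<le> 2 * W"
        using mpos by (intro W_ge) auto
      have "\<bar>osc n k x\<bar> \<le> (16 + C2) * (real n * m) powr (- 1 / 4)"
      proof (cases "real k \<le> 2 * be * real n")
        case True
        have "\<bar>osc n k x\<bar> \<le> 16 * (1 / m) + C2 * (real n * m) powr (- 1 / 4)"
          using osc_bound_gap[OF n x True] mpos by (simp add: m_def C2_def)
        with 1 show ?thesis by (simp add: algebra_simps)
      next
        case False
        have "0 < be * real n" using constants_pos n by simp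
        then have kb: "be * real n < real k" using False by linarith
        have "al * real n \<le> be * real n" using constants_pos by (intro mult_right_mono) auto
        then have "m = real k - be * real n" using kb by (auto simp: m_def gap_def)
        then have "\<bar>osc n k x\<bar> \<le> 4 * (1 / m)"
          using osc_large_index[OF n kb x] by simp
        also have "\<dots> \<le> 4 * (real n * m) powr (- 1 / 4)" using 1 by simp
        also have "\<dots> \<le> (16 + C2) * (real n * m) powr (- 1 / 4)"
          using C12 by (intro mult_right_mono) auto
        finally show ?thesis .
      qed
      also have "\<dots> \<le> (16 + C2) * (2 * W)" using 2 C12 by (intro mult_left_mono) auto
      also have "\<dots> \<le> C * W" using C12 W by (simp add: C_def algebra_simps)
      finally show ?thesis .
    qed
    then show "\<bar>osc n k x\<bar> \<le> C * (real n * (real n powr (1 / 3) + gap n k)) powr (- 1 / 4)"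
      by (simp add: W_def L_def m_def)
  qed
qed

end

section \<open>Power sums and norms\<close>

lemma antiderivative_powr_mono:
  fixes G :: "real \<Rightarrow> real"
  assumes "\<And>u. L \<le> u \<Longrightarrow> (G has_real_derivative u powr (- q)) (at u)"
    and "L \<le> x" "x \<le> y"
  shows "G x \<le> G y"
proof (rule DERIV_nonneg_imp_nondecreasing[OF \<open>x \<le> y\<close>])
  fix u assume "x \<le> u" "u \<le> y"
  then show "\<exists>d. (G has_real_derivative d) (at u) \<and> 0 \<le> d"
    using assms(1)[of u] assms(2) powr_ge_zero by (meson order_trans)
qed

text \<open>Each term is compared with the integral over the unit interval to its right, by the mean
  value theorem; L \<ge> 1 makes z at most twice the left end, whence 2 powr q. The antiderivative
  is a parameter so that q = 1 can use ln.\<close>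

lemma sum_shifted_powr_le:
  fixes G :: "real \<Rightarrow> real"
  assumes "1 \<le> L" "0 \<le> q" and G: "\<And>u. L \<le> u \<Longrightarrow> (G has_real_derivative u powr (- q)) (at u)"
  shows "(\<Sum>i<N. (L + real i) powr (- q)) \<le> 2 powr q * (G (L + real N) - G L)"
proof (induction N)
  case (Suc N)
  have "\<exists>z>L + real N. z < L + real (Suc N) \<and>
      G (L + real (Suc N)) - G (L + real N) = (L + real (Suc N) - (L + real N)) * z powr (- q)"
    by (rule MVT2) (use assms in auto)
  then obtain z where z: "L + real N < z" "z < L + real (Suc N)"
      "G (L + real (Suc N)) - G (L + real N) = z powr (- q)" by auto
  have "(2 * (L + real N)) powr (- q) \<le> z powr (- q)"
    using z assms by (intro powr_mono2') auto
  then have "2 powr q * (2 * (L + real N)) powr (- q) \<le> 2 powr q * z powr (- q)"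
    by (intro mult_left_mono) auto
  also have "2 powr q * (2 * (L + real N)) powr (- q) = (L + real N) powr (- q)"
    using assms by (subst powr_mult) (simp add: powr_minus)
  finally show ?case using Suc.IH z(3) by (simp add: algebra_simps)
qed simp

text \<open>
  Every unit interval contains at most two of the distances of natural numbers to a
  real point, one from each side.
\<close>

lemma sum_dist_powr_le:
  fixes G :: "real \<Rightarrow> real" and y :: real
  assumes "1 \<le> L" "0 \<le> q" and G: "\<And>u. L \<le> u \<Longrightarrow> (G has_real_derivative u powr (- q)) (at u)"
    and S: "finite S" "\<And>k. k \<in> S \<Longrightarrow> \<bar>real k - y\<bar> \<le> R" and "0 \<le> R"
  shows "(\<Sum>k\<in>S. (L + \<bar>real k - y\<bar>) powr (- q)) \<le> 2 * 2 powr q * (G (L + R + 1) - G L)"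
proof -
  define N where "N = Suc (nat \<lfloor>R\<rfloor>)"
  define h where "h k = nat \<lfloor>\<bar>real k - y\<bar>\<rfloor>" for k
  have one_side: "(\<Sum>k\<in>T. (L + \<bar>real k - y\<bar>) powr (- q)) \<le> 2 powr q * (G (L + R + 1) - G L)"
    if T: "T \<subseteq> S" "inj_on h T" for T
  proof -
    have "(\<Sum>k\<in>T. (L + \<bar>real k - y\<bar>) powr (- q)) \<le> (\<Sum>k\<in>T. (L + real (h k)) powr (- q))"
    proof (intro sum_mono powr_mono2')
      fix k show "0 < L + real (h k)" using \<open>1 \<le> L\<close> by (simp add: add_pos_nonneg)
      show "L + real (h k) \<le> L + \<bar>real k - y\<bar>" by (simp add: h_def)
    qed (use \<open>0 \<le> q\<close> in auto)
    also have "\<dots> = (\<Sum>i\<in>h ` T. (L + real i) powr (- q))"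
      using T by (simp add: sum.reindex)
    also have "\<dots> \<le> (\<Sum>i<N. (L + real i) powr (- q))"
    proof (rule sum_mono2)
      show "h ` T \<subseteq> {..<N}"
        using S(2) T(1) by (fastforce simp: h_def N_def less_Suc_eq_le intro!: nat_mono floor_mono)
    qed auto
    also have "\<dots> \<le> 2 powr q * (G (L + real N) - G L)"
      using assms by (intro sum_shifted_powr_le) auto
    also have "G (L + real N) \<le> G (L + R + 1)"
      by (rule antiderivative_powr_mono[OF G]) (use \<open>0 \<le> R\<close> in \<open>auto simp: N_def\<close>)
    finally show ?thesis by simp
  qed
  have "inj_on h {k \<in> S. y \<le> real k}"
  proof (rule inj_onI)
    fix j k assume jk: "j \<in> {k \<in> S. y \<le> real k}" "k \<in> {k \<in> S. y \<le> real k}" "h j = h k"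
    then have "\<lfloor>real j - y\<rfloor> = \<lfloor>real k - y\<rfloor>" by (auto simp: h_def eq_nat_nat_iff)
    then show "j = k" by linarith
  qed
  moreover have "inj_on h {k \<in> S. \<not> y \<le> real k}"
  proof (rule inj_onI)
    fix j k assume jk: "j \<in> {k \<in> S. \<not> y \<le> real k}" "k \<in> {k \<in> S. \<not> y \<le> real k}" "h j = h k"
    then have "\<lfloor>y - real j\<rfloor> = \<lfloor>y - real k\<rfloor>" by (auto simp: h_def eq_nat_nat_iff abs_if)
    then show "j = k" by linarith
  qed
  moreover have "(\<Sum>k\<in>S. (L + \<bar>real k - y\<bar>) powr (- q)) =
      (\<Sum>k\<in>{k \<in> S. y \<le> real k}. (L + \<bar>real k - y\<bar>) powr (- q)) +
      (\<Sum>k\<in>{k \<in> S. \<not> y \<le> real k}. (L + \<bar>real k - y\<bar>) powr (- q))"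
    by (subst sum.union_disjoint[symmetric]) (use S in \<open>auto intro!: sum.cong\<close>)
  ultimately show ?thesis
    using one_side[of "{k \<in> S. y \<le> real k}"] one_side[of "{k \<in> S. \<not> y \<le> real k}"] by auto
qed

lemma powr_antiderivative:
  fixes u :: real
  assumes "0 < u" "q \<noteq> 1"
  shows "((\<lambda>u. u powr (1 - q) / (1 - q)) has_real_derivative u powr (- q)) (at u)"
  using DERIV_cdivide[OF has_real_derivative_powr[OF assms(1), of "1 - q"], of "1 - q"] assms(2)
  by simp

lemma sum_dist_powr_small_exponent:
  fixes y :: real
  assumes "1 \<le> L" "0 \<le> q" "q < 1" "finite S" "\<And>k. k \<in> S \<Longrightarrow> \<bar>real k - y\<bar> \<le> R" "0 \<le> R"
  shows "(\<Sum>k\<in>S. (L + \<bar>real k - y\<bar>) powr (- q)) \<le> 4 / (1 - q) * (L + R + 1) powr (1 - q)"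
proof -
  let ?G = "\<lambda>u::real. u powr (1 - q) / (1 - q)"
  have "(\<Sum>k\<in>S. (L + \<bar>real k - y\<bar>) powr (- q)) \<le> 2 * 2 powr q * (?G (L + R + 1) - ?G L)"
    by (rule sum_dist_powr_le) (use assms powr_antiderivative[of _ q] in auto)
  also have "\<dots> \<le> 2 * 2 powr 1 * ?G (L + R + 1)"
    using assms by (intro mult_mono powr_mono) (auto intro!: divide_right_mono powr_mono2)
  finally show ?thesis by simp
qed

lemma sum_dist_inverse:
  fixes y :: real
  assumes "1 \<le> L" "finite S" "\<And>k. k \<in> S \<Longrightarrow> \<bar>real k - y\<bar> \<le> R" "0 \<le> R"
  shows "(\<Sum>k\<in>S. (L + \<bar>real k - y\<bar>) powr (- 1)) \<le> 4 * ln (L + R + 1)"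
proof -
  have "(\<Sum>k\<in>S. (L + \<bar>real k - y\<bar>) powr (- 1)) \<le> 2 * 2 powr 1 * (ln (L + R + 1) - ln L)"
    by (rule sum_dist_powr_le) (use assms in \<open>auto intro!: derivative_eq_intros simp: powr_minus_divide\<close>)
  also have "\<dots> \<le> 4 * ln (L + R + 1)" using assms by simp
  finally show ?thesis .
qed

lemma sum_dist_powr_large_exponent:
  fixes y :: real
  assumes "1 \<le> L" "1 < q" "finite S"
  shows "(\<Sum>k\<in>S. (L + \<bar>real k - y\<bar>) powr (- q)) \<le> 2 * 2 powr q / (q - 1) * L powr (1 - q)"
proof -
  let ?G = "\<lambda>u::real. u powr (1 - q) / (1 - q)"
  \<comment> \<open>Any common bound for the distances will do: for q > 1 the antiderivative is
    nonpositive, so R disappears from the result.\<close>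
  define R where "R = (\<Sum>k\<in>S. \<bar>real k - y\<bar>)"
  have R: "0 \<le> R" "\<bar>real k - y\<bar> \<le> R" if "k \<in> S" for k
    unfolding R_def using that assms by (auto intro: sum_nonneg member_le_sum)
  have R0: "0 \<le> R" by (auto simp: R_def intro: sum_nonneg)
  have "(\<Sum>k\<in>S. (L + \<bar>real k - y\<bar>) powr (- q)) \<le> 2 * 2 powr q * (?G (L + R + 1) - ?G L)"
    by (rule sum_dist_powr_le) (use assms R R0 powr_antiderivative[of _ q] in auto)
  also have "\<dots> \<le> 2 * 2 powr q * (L powr (1 - q) / (q - 1))"
  proof (rule mult_left_mono)
    have "?G (L + R + 1) \<le> 0" using assms by (intro divide_nonneg_neg) auto
    moreover have "- ?G L = L powr (1 - q) / (q - 1)" 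
      by (metis minus_diff_eq minus_divide_right)
    ultimately show "?G (L + R + 1) - ?G L \<le> L powr (1 - q) / (q - 1)" by linarith
  qed simp
  finally show ?thesis by simp
qed

text \<open>Jensen's inequality for the average of the nonzero terms; zeros are discarded because
  convexity of the power is used on the positive reals. \<open>M\<close> may exceed the number of
  terms because M powr (1 - q) is nonincreasing in M.\<close>

lemma sum_powr_ge_powr_sum:
  fixes a :: "'a \<Rightarrow> real"
  assumes "finite S" "\<And>k. k \<in> S \<Longrightarrow> 0 \<le> a k" "real (card S) \<le> M" "0 < M" "1 \<le> q"
  shows "M powr (1 - q) * (\<Sum>k\<in>S. a k) powr q \<le> (\<Sum>k\<in>S. a k powr q)"
proof -
  define T where "T = {k \<in> S. a k \<noteq> 0}"
  have T: "finite T" "T \<subseteq> S" using assms by (auto simp: T_def)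
  have eq: "(\<Sum>k\<in>S. a k) = (\<Sum>k\<in>T. a k)" "(\<Sum>k\<in>S. a k powr q) = (\<Sum>k\<in>T. a k powr q)"
    by (intro sum.mono_neutral_right; use assms in \<open>auto simp: T_def\<close>)+
  show ?thesis
  proof (cases "T = {}")
    case True then show ?thesis by (simp add: eq)
  next
    case False
    define c where "c = real (card T)"
    have c: "0 < c" using False T by (auto simp: c_def card_gt_0_iff)
    have "c \<le> M" using card_mono[OF assms(1) T(2)] assms(3) by (simp add: c_def)
    have "(\<Sum>k\<in>T. (1 / c) *\<^sub>R a k) powr q \<le> (\<Sum>k\<in>T. 1 / c * a k powr q)"
    proof (rule convex_on_sum[OF T(1) False powr_convex[OF \<open>1 \<le> q\<close>]])
      show "(\<Sum>k\<in>T. 1 / c) = 1" using c by (simp flip: c_def)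
      show "a k \<in> {0<..}" if "k \<in> T" for k
        using that assms(2)[of k] by (auto simp: T_def)
    qed (use c in auto)
    then have "((\<Sum>k\<in>T. a k) / c) powr q \<le> (\<Sum>k\<in>T. a k powr q) / c"
      by (simp add: sum_divide_distrib)
    then have "c * ((\<Sum>k\<in>T. a k) / c) powr q \<le> (\<Sum>k\<in>T. a k powr q)"
      using c by (simp add: field_simps)
    moreover have "0 \<le> (\<Sum>k\<in>T. a k)" using T assms(2) by (auto intro!: sum_nonneg)
    then have "c * ((\<Sum>k\<in>T. a k) / c) powr q = c powr (1 - q) * (\<Sum>k\<in>T. a k) powr q"
      using c by (simp add: powr_divide powr_diff)
    moreover have "M powr (1 - q) * (\<Sum>k\<in>T. a k) powr q \<le> c powr (1 - q) * (\<Sum>k\<in>T. a k) powr q"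
      using c \<open>c \<le> M\<close> \<open>1 \<le> q\<close> by (intro mult_right_mono powr_mono2') auto
    ultimately show ?thesis by (simp add: eq)
  qed
qed

section \<open>The norm versus finite power sums\<close>

lemma lpA_norm_le:
  assumes "0 < p" "p < \<infinity>" "q = enn2real p"
    and "\<And>N. (\<Sum>k<N. cmod (taylor_coeff f k) powr q) \<le> U"
  shows "lpA_norm p f \<le> ennreal (U powr (1 / q))"
proof -
  define S where "S = (\<Sum>k. ennreal (cmod (taylor_coeff f k) powr q))"
  have q: "0 < q" using assms by (auto simp: enn2real_positive_iff top_unique)
  have U: "0 \<le> U" using assms(4)[of 0] by simp
  have "(\<Sum>k<N. ennreal (cmod (taylor_coeff f k) powr q)) \<le> ennreal U" for N
    using assms(4)[of N] by (subst sum_ennreal) (auto intro: ennreal_leI)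
  then have S: "S \<le> ennreal U"
    unfolding S_def suminf_eq_SUP by (intro SUP_least) auto
  then have "S \<noteq> \<infinity>" by (metis ennreal_neq_top infinity_ennreal_def neq_top_trans)
  moreover have "enn2real S \<le> U" using S U by (rule enn2real_leI[rotated])
  then have "enn2real S powr (1 / q) \<le> U powr (1 / q)" using q by (intro powr_mono2) auto
  ultimately show ?thesis
    using less_imp_neq[OF assms(2)] unfolding lpA_norm_def S_def[symmetric] assms(3)[symmetric] Let_def
    by (simp add: ennreal_leI)
qed

lemma lpA_norm_ge:
  assumes "0 < p" "p < \<infinity>" "q = enn2real p"
    and "finite K" "0 \<le> V" "V \<le> (\<Sum>k\<in>K. cmod (taylor_coeff f k) powr q)"
  shows "ennreal (V powr (1 / q)) \<le> lpA_norm p f"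
proof -
  define S where "S = (\<Sum>k. ennreal (cmod (taylor_coeff f k) powr q))"
  have q: "0 < q" using assms by (auto simp: enn2real_positive_iff top_unique)
  have "ennreal V \<le> (\<Sum>k\<in>K. ennreal (cmod (taylor_coeff f k) powr q))"
    using assms(6) by (subst sum_ennreal) (auto intro: ennreal_leI)
  also have "\<dots> \<le> S"
    unfolding S_def by (rule sum_le_suminf) (use assms(4) in auto)
  finally have S: "ennreal V \<le> S" .
  show ?thesis
  proof (cases "S = \<infinity>")
    case True
    then show ?thesis using less_imp_neq[OF assms(2)] unfolding lpA_norm_def S_def[symmetric] assms(3)[symmetric] Let_def by simp
  next
    case False
    then have "V \<le> enn2real S" using S assms(5)
      by (metis enn2real_ennreal enn2real_mono infinity_ennreal_def less_top)
    then have "V powr (1 / q) \<le> enn2real S powr (1 / q)" using q assms(5) by (intro powr_mono2) auto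
    then show ?thesis
      using less_imp_neq[OF assms(2)] False unfolding lpA_norm_def S_def[symmetric] assms(3)[symmetric] Let_def
    by (simp add: ennreal_leI)
  qed
qed

section \<open>Mass near the upper end of the stationary range\<close>

context blaschke_factor begin

text \<open>On [0, x] the value n * poisson differs from be * n by at most half the distance of k to
  be * n. So the first test applies on either side of be * n, even if the phase is stationary beyond
  x.\<close>

lemma osc_outside:
  assumes "0 \<le> x" "x \<le> pi" "real n * (curv * x\<^sup>2) \<le> \<bar>real k - be * real n\<bar> / 2" "real k \<noteq> be * real n"
  shows "\<bar>osc n k x\<bar> \<le> 8 / \<bar>real k - be * real n\<bar>"
proof -
  define j where "j = \<bar>real k - be * real n\<bar>"
  have "\<bar>arc_osc n k 0 x\<bar> \<le> 4 / (j / 2)"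
  proof (rule arc_osc_first)
    fix t assume t: "0 \<le> t" "t \<le> x"
    have "real n * (be - poisson t) \<le> real n * (curv * t\<^sup>2)"
      by (intro mult_left_mono poisson_near_0) auto
    also have "\<dots> \<le> real n * (curv * x\<^sup>2)"
      using t constants_pos by (intro mult_left_mono power_mono) auto
    finally have 1: "be * real n - real n * poisson t \<le> j / 2"
      using assms(3) by (simp add: j_def algebra_simps)
    have "real n * poisson t \<le> real n * be" using poisson_le_be by (intro mult_left_mono) auto
    moreover have "\<bar>z - y\<bar> / 2 \<le> \<bar>w - z\<bar>" if "w \<le> y" "y - w \<le> \<bar>z - y\<bar> / 2" for w y z :: real
      using that by (auto simp: abs_if field_simps split: if_splits)
    ultimately show "j / 2 \<le> \<bar>real n * poisson t - real k\<bar>"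
      using 1 unfolding j_def by (simp add: mult.commute)
  qed (use assms in \<open>auto simp: j_def\<close>)
  then show ?thesis by (simp add: osc_def j_def)
qed

text \<open>Only be * n serves as centre: integrals over a short [0, x] see just the stationary
  points near 0, which belong to indices near be * n. Strict below and weak above, so that
  consecutive annuli are disjoint.\<close>

definition annulus :: "nat \<Rightarrow> real \<Rightarrow> real \<Rightarrow> nat set" where
  "annulus n r m = {k. r < \<bar>real k - be * real n\<bar> \<and> \<bar>real k - be * real n\<bar> \<le> m}"

lemma finite_annulus: "finite (annulus n r m)"
proof (rule finite_subset)
  show "annulus n r m \<subseteq> {..nat \<lceil>be * real n + m\<rceil>}"
    by (auto simp: annulus_def) linarith
qed simp

text \<open>Counting is the case q = 0 of the power sum bound; 4 * (m + 2) \<le> 12 * m.\<close>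

lemma card_annulus:
  assumes "1 \<le> m"
  shows "real (card (annulus n r m)) \<le> 12 * m"
proof -
  have "(\<Sum>k\<in>annulus n r m. (1 + \<bar>real k - be * real n\<bar>) powr (- 0)) \<le> 4 / (1 - 0) * (1 + m + 1) powr (1 - 0)"
    by (rule sum_dist_powr_small_exponent) (use assms finite_annulus in \<open>auto simp: annulus_def\<close>)
  also have "(\<Sum>k\<in>annulus n r m. (1 + \<bar>real k - be * real n\<bar>) powr (- 0)) = real (card (annulus n r m))"
    by (subst sum.cong[OF refl, where h = "\<lambda>_. 1"]) auto
  finally show ?thesis using assms by simp
qed

text \<open>
  The sum of coef n k * osc n k x over all k equals x. For x of order sqrt (m / n) the indices far
  from be * n contribute little, because there the phase has no stationary point in [0, x], and
  so do the few indices very close to be * n; the annulus in between carries the sum.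
\<close>

lemma annulus_mass:
  obtains A \<eta> c where "1 < A" "0 < \<eta>" "0 < c"
    and "\<And>n m. 0 < n \<Longrightarrow> A * real n powr (1 / 3) \<le> m \<Longrightarrow> m \<le> \<eta> * real n \<Longrightarrow>
           c * m powr (3 / 4) * real n powr (- 1 / 4) \<le> (\<Sum>k\<in>annulus n (m / A) m. cmod (coef n k))"
proof -
  obtain C where C: "0 < C" and osc_le: "\<And>n k x. 0 < n \<Longrightarrow> 0 \<le> x \<Longrightarrow> x \<le> pi \<Longrightarrow>
      \<bar>osc n k x\<bar> \<le> C * (real n * (real n powr (1 / 3) + gap n k)) powr (- 1 / 4)"
    using osc_bound by blast
  \<comment> \<open>An index within \<eta> * n of be * n is at least as far from al * n, so its gap
    is its distance to be * n.\<close>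
  define \<eta> where "\<eta> = (be - al) / 2"
  have \<eta>: "0 < \<eta>" using constants_pos by (simp add: \<eta>_def)
  define e where "e = 1 / (2 * curv + \<eta>)"
  have e: "0 < e" "e * curv \<le> 1 / 2" "e * \<eta> \<le> 1"
    using constants_pos \<eta> by (auto simp: e_def field_simps)
  \<comment> \<open>Errors in units of u / sqrt A: from indices very near be * n, from those beyond
    m but no nearer to al * n, and from those nearer to al * n.\<close>
  define K1 where "K1 = C\<^sup>2 * 8 * sqrt 3"
  define K2 where "K2 = 8 * C * 2 powr (5 / 4) * (2 * 2 powr (5 / 4) / (1 / 4))"
  define K3 where "K3 = 8 / \<eta> * C * (4 / (3 / 4)) * (be + 2) powr (3 / 4)"
  define K where "K = K1 + K2 + K3"
  have K: "0 < K1" "0 < K2" "0 < K3" "0 < K"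
    using C \<eta> constants_pos by (auto simp: K1_def K2_def K3_def K_def intro!: add_pos_pos mult_pos_pos)
  \<comment> \<open>This makes the three errors together at most sqrt e / 4 * u, half of \<delta> /
    2 = sqrt e / 2 * u.\<close>
  define A where "A = (4 * K / sqrt e)\<^sup>2 + 1"
  have A: "1 < A" using K e by (simp add: A_def)
  have sqrtA: "K / sqrt A \<le> sqrt e / 4"
  proof -
    have "4 * K / sqrt e = sqrt ((4 * K / sqrt e)\<^sup>2)" using K e by simp
    also have "\<dots> \<le> sqrt A" unfolding A_def by (rule real_sqrt_le_mono) simp
    finally show ?thesis using e A by (simp add: field_simps)
  qed
  define c where "c = sqrt e / 4 / (C * A powr (1 / 4))"
  show thesis
  proof
    show "1 < A" "0 < \<eta>" by fact+
    show "0 < c" using e C A by (simp add: c_def)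
    fix n :: nat and m :: real
    define L where "L = real n powr (1 / 3)"
    assume n: "0 < n" and mL: "A * real n powr (1 / 3) \<le> m" and m\<eta>: "m \<le> \<eta> * real n"
    have L: "1 \<le> L" using n by (auto simp: L_def intro!: ge_one_powr_ge_zero)
    have L3: "L ^ 3 = real n" using n by (simp add: L_def powr_power)
    have Ln: "L \<le> real n" using n powr_mono[of "1 / 3" 1 "real n"] by (simp add: L_def)
    have AL: "A * L \<le> m" using mL by (simp add: L_def)
    have "A * 1 \<le> A * L" using A L by (intro mult_left_mono) auto
    then have Am: "A \<le> m" using AL by simp
    have m: "1 < m" using A Am by simp
    have LmA: "L \<le> m / A" using AL A by (simp add: field_simps)
    have mA: "0 < m / A" "m / A \<le> m" using m A by (auto simp: field_simps)
    \<comment> \<open>The point x of the duality sum; the factor e keeps n * curv * \<delta>^2 below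
      m / 2, as \<open>osc_outside\<close> requires for indices beyond m.\<close>
    define \<delta> where "\<delta> = sqrt (e * m / real n)"
    define u where "u = sqrt (m / real n)"
    have u: "0 < u" using m n by (simp add: u_def)
    have \<delta>u: "\<delta> = sqrt e * u" by (simp add: \<delta>_def u_def flip: real_sqrt_mult)
    have \<delta>2: "\<delta>\<^sup>2 = e * m / real n" using e m by (simp add: \<delta>_def)
    have "e * m \<le> e * (\<eta> * real n)" using m\<eta> e by (intro mult_left_mono) auto
    also have "\<dots> \<le> 1 * real n" unfolding mult.assoc[symmetric] using e by (intro mult_right_mono) auto
    finally have "\<delta> \<le> 1" using n unfolding \<delta>_def by simp
    then have \<delta>: "0 < \<delta>" "\<delta> \<le> pi" using u e pi_ge_two by (auto simp: \<delta>u)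
    have flat: "real n * (curv * \<delta>\<^sup>2) \<le> m / 2"
    proof -
      have "real n * (curv * \<delta>\<^sup>2) = (e * curv) * m" using n by (simp add: \<delta>2)
      also have "\<dots> \<le> 1 / 2 * m" using e m by (intro mult_right_mono) auto
      finally show ?thesis by simp
    qed
    define j where "j k = \<bar>real k - be * real n\<bar>" for k
    define l where "l k = \<bar>real k - al * real n\<bar>" for k
    have gap: "gap n k = min (l k) (j k)" for k by (simp add: gap_def j_def l_def)
    have jl: "2 * \<eta> * real n \<le> j k + l k" for k
    proof -
      have "2 * \<eta> * real n = be * real n - al * real n" by (simp add: \<eta>_def left_diff_distrib)
      then show ?thesis unfolding j_def l_def by linarith
    qed
    have gap_near: "gap n k = j k" if "j k \<le> m" for k
      using that jl[of k] m\<eta> by (simp add: gap)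
    have out: "\<bar>osc n k \<delta>\<bar> \<le> 8 / j k" if "m < j k" for k
      unfolding j_def by (rule osc_outside) (use \<delta> flat that m in \<open>auto simp: j_def\<close>)
    define b where "b k = \<bar>osc n k pi / pi * osc n k \<delta>\<bar>" for k
    have b_le: "b k \<le> \<bar>osc n k pi\<bar> * \<bar>osc n k \<delta>\<bar>" for k
    proof -
      have "\<bar>osc n k pi\<bar> / pi \<le> \<bar>osc n k pi\<bar>"
        using pi_ge_two mult_left_mono[of 1 pi "\<bar>osc n k pi\<bar>"] by (simp add: divide_le_eq)
      then show ?thesis unfolding b_def abs_mult by (intro mult_right_mono) auto
    qed
    \<comment> \<open>A partial sum above \<delta> / 2 replaces the series, so that only finite sums
      have to be split.\<close>
    have "(\<lambda>N. \<Sum>k<N. osc n k pi / pi * osc n k \<delta>) \<longlonglongrightarrow> \<delta>"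
      using sum_coef_osc[of \<delta> n] \<delta> by (simp add: sums_def)
    then have "eventually (\<lambda>N. \<delta> / 2 < (\<Sum>k<N. osc n k pi / pi * osc n k \<delta>)) sequentially"
      by (rule order_tendstoD) (use \<delta> in simp)
    then obtain N where N: "\<delta> / 2 < (\<Sum>k<N. osc n k pi / pi * osc n k \<delta>)"
      by (meson eventually_sequentially order_refl)
    define inner where "inner = {k \<in> {..<N}. j k \<le> m / A}"
    define ann where "ann = {k \<in> {..<N}. m / A < j k \<and> j k \<le> m}"
    define outer where "outer = {k \<in> {..<N}. m < j k \<and> j k \<le> l k}"
    define far where "far = {k \<in> {..<N}. m < j k \<and> l k < j k}"
    have "\<delta> / 2 \<le> (\<Sum>k<N. b k)"
    proof -
      have "(\<Sum>k<N. osc n k pi / pi * osc n k \<delta>) \<le> (\<Sum>k<N. b k)"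
        unfolding b_def by (intro sum_mono abs_ge_self)
      with N show ?thesis by linarith
    qed
    also have "{..<N} = (inner \<union> ann) \<union> (outer \<union> far)"
      using mA(2) by (auto simp: inner_def ann_def outer_def far_def)
    also have "sum b \<dots> = (sum b inner + sum b ann) + (sum b outer + sum b far)"
      using mA by (subst sum.union_disjoint; (subst sum.union_disjoint)?;
          (force simp: inner_def ann_def outer_def far_def)?)+
    finally have split: "\<delta> / 2 \<le> sum b inner + sum b ann + sum b outer + sum b far" by simp
    \<comment> \<open>Both factors obey the general bound; summing (n * (L + j)) powr (-1/2) over j
      \<le> m / A gives the order sqrt (m / (A * n)).\<close>
    have inner_le: "sum b inner \<le> K1 * (u / sqrt A)"
    proof -
      have "sum b inner \<le> (\<Sum>k\<in>inner. C\<^sup>2 * real n powr (- (1 / 2)) * (L + \<bar>real k - be * real n\<bar>) powr (- (1 / 2)))"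
      proof (rule sum_mono)
        fix k assume "k \<in> inner"
        then have g: "gap n k = j k" using mA by (intro gap_near) (auto simp: inner_def)
        have "b k \<le> (C * (real n * (L + j k)) powr (- 1 / 4)) * (C * (real n * (L + j k)) powr (- 1 / 4))"
          using b_le[of k] osc_le[OF n, of pi k] osc_le[OF n, of \<delta> k] \<delta> C
          by (elim order_trans) (intro mult_mono, auto simp: g L_def)
        also have "\<dots> = C\<^sup>2 * (real n * (L + j k)) powr (- (1 / 2))"
          by (simp add: power2_eq_square powr_add[symmetric] mult_ac)
        also have "\<dots> = C\<^sup>2 * real n powr (- (1 / 2)) * (L + j k) powr (- (1 / 2))"
          using L by (subst powr_mult) (auto simp: j_def)
        finally show "b k \<le> C\<^sup>2 * real n powr (- (1 / 2)) * (L + \<bar>real k - be * real n\<bar>) powr (- (1 / 2))"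
          by (simp add: j_def)
      qed
      also have "\<dots> \<le> C\<^sup>2 * real n powr (- (1 / 2)) * (4 / (1 - 1 / 2) * (L + m / A + 1) powr (1 - 1 / 2))"
        unfolding sum_distrib_left[symmetric] using L mA
        by (intro mult_left_mono sum_dist_powr_small_exponent) (auto simp: inner_def j_def)
      also have "\<dots> \<le> C\<^sup>2 * real n powr (- (1 / 2)) * (8 * (3 * (m / A)) powr (1 / 2))"
        using LmA L by (intro mult_left_mono) (auto intro!: powr_mono2)
      also have "\<dots> = K1 * (u / sqrt A)"
        using m A n by (simp add: K1_def u_def powr_half_sqrt powr_minus_divide real_sqrt_mult real_sqrt_divide)
      finally show ?thesis .
    qed
    \<comment> \<open>The coefficient obeys the general bound and the partial integral is at most 8
      / j; the sum of j powr (-5/4) converges and is governed by j near m.\<close>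
    have outer_le: "sum b outer \<le> K2 * (u / sqrt A)"
    proof -
      have "sum b outer \<le> (\<Sum>k\<in>outer. 8 * C * 2 powr (5 / 4) * real n powr (- (1 / 4)) * (m + \<bar>real k - be * real n\<bar>) powr (- (5 / 4)))"
      proof (rule sum_mono)
        fix k assume "k \<in> outer"
        then have k: "gap n k = j k" "m < j k" by (auto simp: outer_def gap)
        have jpos: "0 < j k" using k m by simp
        have "\<bar>osc n k pi\<bar> \<le> C * (real n * (L + j k)) powr (- 1 / 4)"
          using osc_le[OF n, of pi k] by (simp add: k L_def)
        also have "\<dots> \<le> C * (real n * j k) powr (- 1 / 4)"
          using C L n jpos by (intro mult_left_mono powr_mono2') auto
        finally have 1: "\<bar>osc n k pi\<bar> \<le> C * (real n * j k) powr (- 1 / 4)" .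
        have "b k \<le> C * (real n * j k) powr (- 1 / 4) * (8 / j k)"
          using b_le[of k] 1 out[OF k(2)] C by (elim order_trans) (intro mult_mono, auto)
        also have "\<dots> = 8 * C * real n powr (- (1 / 4)) * j k powr (- (5 / 4))"
          using n jpos powr_add[of "j k" "1 / 4" 1] by (simp add: powr_mult powr_minus_divide mult_ac)
        also have "\<dots> \<le> 8 * C * real n powr (- (1 / 4)) * (2 powr (5 / 4) * (m + j k) powr (- (5 / 4)))"
        proof (rule mult_left_mono)
          have "(2 * j k) powr (- (5 / 4)) \<le> (m + j k) powr (- (5 / 4))"
            using k m by (intro powr_mono2') auto
          then have "2 powr (5 / 4) * (2 * j k) powr (- (5 / 4)) \<le> 2 powr (5 / 4) * (m + j k) powr (- (5 / 4))"
            by (intro mult_left_mono) auto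
          then show "j k powr (- (5 / 4)) \<le> 2 powr (5 / 4) * (m + j k) powr (- (5 / 4))"
            using jpos by (simp add: powr_mult powr_minus_divide)
        qed (use C in auto)
        finally show "b k \<le> 8 * C * 2 powr (5 / 4) * real n powr (- (1 / 4)) * (m + \<bar>real k - be * real n\<bar>) powr (- (5 / 4))"
          by (simp add: j_def mult_ac)
      qed
      also have "\<dots> \<le> 8 * C * 2 powr (5 / 4) * real n powr (- (1 / 4)) * (2 * 2 powr (5 / 4) / (5 / 4 - 1) * m powr (1 - 5 / 4))"
        unfolding sum_distrib_left[symmetric] using C m
        by (intro mult_left_mono sum_dist_powr_large_exponent) (auto simp: outer_def)
      also have "\<dots> = K2 * (real n * m) powr (- (1 / 4))"
        by (simp add: K2_def powr_mult)
      also have "\<dots> \<le> K2 * (u / sqrt A)"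
      proof (rule mult_left_mono)
        \<comment> \<open>The ratio to u is small because m \<ge> A * n powr (1/3); it is then
          weakened to 1 / sqrt A to match the other errors.\<close>
        have "(real n * m) powr (- (1 / 4)) = (real n / m ^ 3) powr (1 / 4) * u"
        proof -
          have "u = (m / real n) powr (1 / 2)" using m n by (simp add: u_def powr_half_sqrt)
          also have "\<dots> = ((m / real n)\<^sup>2) powr (1 / 4)" using m n by (simp add: powr_powr flip: powr_numeral)
          finally have "(real n / m ^ 3) powr (1 / 4) * u = (real n / m ^ 3 * (m / real n)\<^sup>2) powr (1 / 4)"
            using m n by (simp only: powr_mult)
          also have "real n / m ^ 3 * (m / real n)\<^sup>2 = inverse (real n * m)"
            using m n by (simp add: power2_eq_square power3_eq_cube field_simps)
          finally show ?thesis using m n by (simp add: powr_minus powr_mult inverse_eq_divide powr_divide)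
        qed
        also have "\<dots> \<le> (1 / A\<^sup>2) powr (1 / 4) * u"
        proof (intro mult_right_mono powr_mono2)
          have "L ^ 3 \<le> (m / A) ^ 3" using LmA L by (intro power_mono) auto
          then have "real n / m ^ 3 \<le> 1 / A ^ 3"
            using m A by (simp add: L3 field_simps power_divide)
          also have "\<dots> \<le> 1 / A\<^sup>2" using A by (intro divide_left_mono power_increasing) auto
          finally show "real n / m ^ 3 \<le> 1 / A\<^sup>2" .
        qed (use u m in auto)
        also have "(1 / A\<^sup>2) powr (1 / 4) = 1 / sqrt A"
          using A by (simp add: powr_divide powr_powr powr_half_sqrt flip: powr_numeral)
        finally show "(real n * m) powr (- (1 / 4)) \<le> u / sqrt A" by simp
      qed (use K in simp)
      finally show ?thesis .
    qed
    \<comment> \<open>Coefficients near al * n may be large, but their stationary points lie far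
      from [0, \<delta>], so the partial integral is O(1 / n) and the sum O(1 / sqrt n).\<close>
    have far_le: "sum b far \<le> K3 * (u / sqrt A)"
    proof -
      have farD: "l k \<le> be * real n" "gap n k = l k" "\<bar>osc n k \<delta>\<bar> \<le> 8 / \<eta> / real n" if "k \<in> far" for k
      proof -
        have k: "m < j k" "l k < j k" using that by (auto simp: far_def)
        have "al * real n \<le> be * real n" "0 \<le> al * real n" using constants_pos by (auto intro: mult_right_mono)
        then show "l k \<le> be * real n" using k(2) unfolding j_def l_def by (cases "real k \<le> al * real n") auto
        show "gap n k = l k" using k by (simp add: gap)
        have "\<eta> * real n \<le> j k" using jl[of k] k by linarith
        then have "8 / j k \<le> 8 / (\<eta> * real n)" using \<eta> n by (intro frac_le) auto
        then show "\<bar>osc n k \<delta>\<bar> \<le> 8 / \<eta> / real n" using out[OF k(1)] by simp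
      qed
      have "sum b far \<le> (\<Sum>k\<in>far. 8 / \<eta> / real n * C * real n powr (- (1 / 4)) * (L + \<bar>real k - al * real n\<bar>) powr (- (1 / 4)))"
      proof (rule sum_mono)
        fix k assume k: "k \<in> far"
        have "b k \<le> C * (real n * (L + l k)) powr (- 1 / 4) * (8 / \<eta> / real n)"
          using b_le[of k] osc_le[OF n, of pi k] farD(3)[OF k] C
          by (elim order_trans) (intro mult_mono, auto simp: farD(2)[OF k] L_def)
        also have "\<dots> = 8 / \<eta> / real n * C * real n powr (- (1 / 4)) * (L + l k) powr (- (1 / 4))"
          by (simp add: powr_mult mult_ac)
        finally show "b k \<le> 8 / \<eta> / real n * C * real n powr (- (1 / 4)) * (L + \<bar>real k - al * real n\<bar>) powr (- (1 / 4))"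
          by (simp add: l_def)
      qed
      also have "\<dots> \<le> 8 / \<eta> / real n * C * real n powr (- (1 / 4)) * (4 / (1 - 1 / 4) * (L + be * real n + 1) powr (1 - 1 / 4))"
        unfolding sum_distrib_left[symmetric] using C \<eta> L n constants_pos farD(1)
        by (intro mult_left_mono sum_dist_powr_small_exponent) (auto simp: far_def l_def)
      also have "\<dots> \<le> 8 / \<eta> / real n * C * real n powr (- (1 / 4)) * (4 / (1 - 1 / 4) * ((be + 2) * real n) powr (1 - 1 / 4))"
      proof (intro mult_left_mono powr_mono2)
        show "L + be * real n + 1 \<le> (be + 2) * real n" using Ln L by (simp add: algebra_simps)
      qed (use C \<eta> L constants_pos in auto)
      also have "\<dots> = K3 * (real n powr (- (1 / 4)) * real n powr (3 / 4) / real n)"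
        by (simp add: K3_def powr_mult mult_ac)
      also have "real n powr (- (1 / 4)) * real n powr (3 / 4) / real n = 1 / sqrt (real n)"
        using n by (simp add: powr_half_sqrt real_div_sqrt real_sqrt_gt_zero field_simps flip: powr_add)
      also have "K3 * (1 / sqrt (real n)) \<le> K3 * (u / sqrt A)"
      proof (rule mult_left_mono)
        have "sqrt A \<le> sqrt m" using Am by simp
        then have "1 \<le> sqrt m / sqrt A" using A by simp
        then have "1 / sqrt (real n) \<le> sqrt m / sqrt A / sqrt (real n)" by (intro divide_right_mono) auto
        then show "1 / sqrt (real n) \<le> u / sqrt A" by (simp add: u_def real_sqrt_divide mult.commute)
      qed (use K in simp)
      finally show ?thesis .
    qed
    have "sum b inner + sum b outer + sum b far \<le> K * (u / sqrt A)"
      using inner_le outer_le far_le by (simp only: K_def distrib_right)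
    also have "\<dots> = K / sqrt A * u" by simp
    also have "\<dots> \<le> sqrt e / 4 * u" using sqrtA u by (intro mult_right_mono) auto
    finally have ann_ge: "sqrt e / 4 * u \<le> sum b ann" using split by (simp add: \<delta>u)
    \<comment> \<open>Here the general bound is applied only to the partial integral, so that the
      moduli of the coefficients remain in the sum.\<close>
    also have "sum b ann \<le> (\<Sum>k\<in>ann. C * (real n * (m / A)) powr (- 1 / 4) * cmod (coef n k))"
    proof (rule sum_mono)
      fix k assume "k \<in> ann"
      then have k: "m / A < j k" "gap n k = j k" using gap_near by (auto simp: ann_def)
      have "\<bar>osc n k \<delta>\<bar> \<le> C * (real n * (L + j k)) powr (- 1 / 4)"
        using osc_le[OF n, of \<delta> k] \<delta> by (simp add: k L_def)
      also have "\<dots> \<le> C * (real n * (m / A)) powr (- 1 / 4)"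
      proof (intro mult_left_mono powr_mono2')
        show "0 < real n * (m / A)" using n mA by (intro mult_pos_pos) auto
      qed (use C k L in auto)
      finally have "\<bar>osc n k \<delta>\<bar> * cmod (coef n k) \<le> C * (real n * (m / A)) powr (- 1 / 4) * cmod (coef n k)"
        by (intro mult_right_mono) auto
      then show "b k \<le> C * (real n * (m / A)) powr (- 1 / 4) * cmod (coef n k)"
        by (simp add: b_def coef_eq_osc norm_divide abs_mult mult.commute)
    qed
    also have "\<dots> \<le> C * (real n * (m / A)) powr (- 1 / 4) * (\<Sum>k\<in>annulus n (m / A) m. cmod (coef n k))"
      unfolding sum_distrib_left[symmetric] using C finite_annulus
      by (intro mult_left_mono sum_mono2) (auto simp: ann_def annulus_def j_def)
    finally have main: "sqrt e / 4 * u \<le> C * (real n * (m / A)) powr (- 1 / 4) * (\<Sum>k\<in>annulus n (m / A) m. cmod (coef n k))" .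
    define T where "T = (\<Sum>k\<in>annulus n (m / A) m. cmod (coef n k))"
    define Z where "Z = C * (real n * (m / A)) powr (- 1 / 4)"
    have Z: "0 < Z" using C n m A by (simp add: Z_def)
    have "c * m powr (3 / 4) * real n powr (- 1 / 4) = sqrt e / 4 * u / Z"
    proof -
      have u': "u = m powr (1 / 2) / real n powr (1 / 2)"
        using m n by (simp add: u_def powr_half_sqrt real_sqrt_divide)
      have Z': "Z = C * A powr (1 / 4) / (real n powr (1 / 4) * m powr (1 / 4))"
        using m n A by (simp add: Z_def powr_mult powr_divide powr_minus_divide)
      have mm: "m powr (3 / 4) = m powr (1 / 2) * m powr (1 / 4)" by (simp flip: powr_add)
      have nn: "real n powr (1 / 2) = real n powr (1 / 4) * real n powr (1 / 4)" by (simp flip: powr_add)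
      show ?thesis
        unfolding u' Z' mm nn c_def using m n A C by (simp add: powr_minus_divide)
    qed
    also have "\<dots> \<le> T" using main pos_divide_le_eq[OF Z] mult.commute[of Z T]
      unfolding T_def[symmetric] Z_def[symmetric] by metis
    finally show "c * m powr (3 / 4) * real n powr (- 1 / 4) \<le> (\<Sum>k\<in>annulus n (m / A) m. cmod (coef n k))"
      by (simp add: T_def)
  qed
qed

end

section \<open>Two-sided bounds for the norms\<close>

text \<open>The q-th power of \<open>Psi\<close> for a real exponent: the expected order of the sum
  of q-th powers of the coefficients.\<close>

definition power_sum_rate :: "real \<Rightarrow> nat \<Rightarrow> real" where
  "power_sum_rate q n =
     (if q < 4 then real n powr (1 - q / 2)
      else if q = 4 then ln (real n) / real n
      else real n powr ((1 - q) / 3))"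

lemma power_sum_rate_nonneg: "0 \<le> power_sum_rate q n"
  by (cases "n = 0") (auto simp: power_sum_rate_def)

lemma Psi_finite:
  assumes "0 < q"
  shows "Psi (ennreal q) n = power_sum_rate q n powr (1 / q)"
proof -
  have "ennreal q < 4 \<longleftrightarrow> q < 4" "ennreal q = 4 \<longleftrightarrow> q = 4"
    using ennreal_less_iff[of q 4] ennreal_inj[of q 4] assms by auto
  moreover have "(2 - q) / (2 * q) = (1 - q / 2) * (1 / q)" using assms by (simp add: field_simps)
  moreover have "(1 - q) / (3 * q) = (1 - q) / 3 * (1 / q)" by simp
  ultimately show ?thesis
    using assms by (simp only: Psi_def power_sum_rate_def powr_powr enn2real_ennreal less_imp_le ennreal_less_top infinity_ennreal_def if_True split: if_splits) simp
qed

lemma Psi_infinity: "Psi \<infinity> n = real n powr (- 1 / 3)"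
  by (simp add: Psi_def)

context blaschke_factor begin

lemma coef_le_osc: "cmod (coef n k) \<le> \<bar>osc n k pi\<bar>"
  using pi_ge_two mult_left_mono[of 1 pi "\<bar>osc n k pi\<bar>"]
  by (simp add: coef_eq_osc norm_divide divide_le_eq)

text \<open>Beyond twice the upper end, k - be * n is at least (n + k) / 4. The form n + k fits the
  shifted power sums with L = n and centre 0.\<close>

lemma coef_tail:
  assumes "0 < n" "2 * be * real n < real k"
  shows "cmod (coef n k) \<le> 16 * (real n + real k) powr (- 1)"
proof -
  have ben: "1 * real n \<le> be * real n" using constants_pos by (intro mult_right_mono) auto
  have "\<bar>osc n k pi\<bar> \<le> 4 / (real k - be * real n)"
    by (rule osc_large_index) (use assms ben in auto)
  also have "\<dots> \<le> 4 / ((real n + real k) / 4)"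
  proof (rule divide_left_mono)
    show "(real n + real k) / 4 \<le> real k - be * real n" using assms(2) ben unfolding mult.assoc[of 2] by (simp add: field_simps)
    then show "0 < (real k - be * real n) * ((real n + real k) / 4)" using assms by (intro mult_pos_pos) auto
  qed simp
  finally show ?thesis using coef_le_osc[of n k] assms by (simp add: powr_minus_divide)
qed

text \<open>E abstracts a bound for distance sums about any centre, so that the three ranges of q
  share the argument; it is used at al * n and be * n. Indices beyond 2 * be * n account for n powr
  (1 - q).\<close>

lemma coef_power_sum_le:
  assumes q: "1 < q"
  obtains C where "0 < C"
    and "\<And>n N E. 0 < n \<Longrightarrow>
      (\<And>y S. finite S \<Longrightarrow> (\<And>k. k \<in> S \<Longrightarrow> \<bar>real k - y\<bar> \<le> 2 * be * real n) \<Longrightarrow>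
         (\<Sum>k\<in>S. (real n powr (1 / 3) + \<bar>real k - y\<bar>) powr (- (q / 4))) \<le> E) \<Longrightarrow>
      (\<Sum>k<N. cmod (coef n k) powr q) \<le> C * (real n powr (- (q / 4)) * E + real n powr (1 - q))"
proof -
  obtain C where C: "0 < C" and osc_le: "\<And>n k x. 0 < n \<Longrightarrow> 0 \<le> x \<Longrightarrow> x \<le> pi \<Longrightarrow>
      \<bar>osc n k x\<bar> \<le> C * (real n * (real n powr (1 / 3) + gap n k)) powr (- 1 / 4)"
    using osc_bound by blast
  define D where "D = 2 * C powr q + 16 powr q * (2 * 2 powr q / (q - 1))"
  show thesis
  proof
    show "0 < D" using C q by (auto simp: D_def intro!: add_pos_pos)
    fix n N :: nat and E :: real
    assume n: "0 < n" and E: "\<And>y S. finite S \<Longrightarrow> (\<And>k. k \<in> S \<Longrightarrow> \<bar>real k - y\<bar> \<le> 2 * be * real n) \<Longrightarrow>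
         (\<Sum>k\<in>S. (real n powr (1 / 3) + \<bar>real k - y\<bar>) powr (- (q / 4))) \<le> E"
    define L where "L = real n powr (1 / 3)"
    have L: "1 \<le> L" using n by (auto simp: L_def intro!: ge_one_powr_ge_zero)
    have E0: "0 \<le> E" using E[of "{}"] by simp
    define S where "S = {k \<in> {..<N}. real k \<le> 2 * be * real n}"
    define T where "T = {k \<in> {..<N}. \<not> real k \<le> 2 * be * real n}"
    have ben: "real n \<le> be * real n" using constants_pos by (simp add: mult_le_cancel_right1)
    have aln: "0 \<le> al * real n" "al * real n \<le> be * real n" using constants_pos by (auto intro: mult_right_mono)
    have near: "(\<Sum>k\<in>S. cmod (coef n k) powr q) \<le> C powr q * (real n powr (- (q / 4)) * (2 * E))"
    proof -
      have "(\<Sum>k\<in>S. cmod (coef n k) powr q) \<le> (\<Sum>k\<in>S. C powr q * (real n powr (- (q / 4)) *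
          ((L + \<bar>real k - al * real n\<bar>) powr (- (q / 4)) + (L + \<bar>real k - be * real n\<bar>) powr (- (q / 4)))))"
      proof (rule sum_mono)
        fix k
        have g: "0 \<le> gap n k" by (simp add: gap_def)
        have "cmod (coef n k) \<le> C * (real n * (L + gap n k)) powr (- 1 / 4)"
          using coef_le_osc[of n k] osc_le[OF n, of pi k] by (simp add: L_def)
        then have "cmod (coef n k) powr q \<le> (C * (real n * (L + gap n k)) powr (- 1 / 4)) powr q"
          using q by (intro powr_mono2) auto
        also have "\<dots> = C powr q * (real n powr (- (q / 4)) * (L + gap n k) powr (- (q / 4)))"
          by (simp add: powr_mult powr_powr)
        \<comment> \<open>The minimum in \<open>gap\<close> is one of the two distances, so the left
          side equals one of the two nonnegative summands.\<close>
        also have "(L + gap n k) powr (- (q / 4)) \<le>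
            (L + \<bar>real k - al * real n\<bar>) powr (- (q / 4)) + (L + \<bar>real k - be * real n\<bar>) powr (- (q / 4))"
          by (auto simp: gap_def min_def)
        finally show "cmod (coef n k) powr q \<le> C powr q * (real n powr (- (q / 4)) *
          ((L + \<bar>real k - al * real n\<bar>) powr (- (q / 4)) + (L + \<bar>real k - be * real n\<bar>) powr (- (q / 4))))"
          by (simp add: mult_left_mono)
      qed
      also have "\<dots> = C powr q * (real n powr (- (q / 4)) * ((\<Sum>k\<in>S. (L + \<bar>real k - al * real n\<bar>) powr (- (q / 4))) +
          (\<Sum>k\<in>S. (L + \<bar>real k - be * real n\<bar>) powr (- (q / 4)))))"
        unfolding sum_distrib_left[symmetric] sum.distrib by (rule refl)
      also have "\<dots> \<le> C powr q * (real n powr (- (q / 4)) * (E + E))"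
        unfolding L_def using ben aln by (intro mult_left_mono add_mono E) (auto simp: S_def)
      finally show ?thesis by simp
    qed
    have tail: "(\<Sum>k\<in>T. cmod (coef n k) powr q) \<le> 16 powr q * (2 * 2 powr q / (q - 1) * real n powr (1 - q))"
    proof -
      have "(\<Sum>k\<in>T. cmod (coef n k) powr q) \<le> (\<Sum>k\<in>T. 16 powr q * (real n + \<bar>real k - 0\<bar>) powr (- q))"
      proof (rule sum_mono)
        fix k assume "k \<in> T"
        then have "cmod (coef n k) powr q \<le> (16 * (real n + real k) powr (- 1)) powr q"
          using q n by (intro powr_mono2 coef_tail) (auto simp: T_def)
        also have "\<dots> = 16 powr q * (real n + real k) powr (- q)"
          by (simp only: powr_mult powr_powr) simp
        finally show "cmod (coef n k) powr q \<le> 16 powr q * (real n + \<bar>real k - 0\<bar>) powr (- q)" by simp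
      qed
      also have "\<dots> \<le> 16 powr q * (2 * 2 powr q / (q - 1) * real n powr (1 - q))"
        unfolding sum_distrib_left[symmetric] using q n
        by (intro mult_left_mono sum_dist_powr_large_exponent) (auto simp: T_def)
      finally show ?thesis .
    qed
    have "(\<Sum>k<N. cmod (coef n k) powr q) = (\<Sum>k\<in>S. cmod (coef n k) powr q) + (\<Sum>k\<in>T. cmod (coef n k) powr q)"
      by (subst sum.union_disjoint[symmetric]) (auto simp: S_def T_def intro!: sum.cong)
    also have "\<dots> \<le> 2 * C powr q * (real n powr (- (q / 4)) * E) + 16 powr q * (2 * 2 powr q / (q - 1)) * real n powr (1 - q)"
      using near tail by simp
    also have "\<dots> \<le> D * (real n powr (- (q / 4)) * E) + D * real n powr (1 - q)"
      using q E0 by (intro add_mono mult_right_mono) (auto simp: D_def)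
    finally show "(\<Sum>k<N. cmod (coef n k) powr q) \<le> D * (real n powr (- (q / 4)) * E + real n powr (1 - q))"
      by (simp add: distrib_left)
  qed
qed

text \<open>As q / 4 is below, equal to or above 1, the distance sum is dominated by distances of
  order n, spread over all scales, or dominated by distances of order n powr (1/3). The tail n powr
  (1 - q) never exceeds a constant times the main term.\<close>

lemma coef_power_sum_upper:
  assumes q: "1 < q"
  obtains C where "0 < C"
    and "\<And>n N. 1 \<le> n \<Longrightarrow> (q = 4 \<Longrightarrow> 2 \<le> n) \<Longrightarrow>
      (\<Sum>k<N. cmod (coef n k) powr q) \<le> C * power_sum_rate q n"
proof -
  obtain C where C: "0 < C"
    and le: "\<And>n N E. 0 < n \<Longrightarrow>
      (\<And>y S. finite S \<Longrightarrow> (\<And>k. k \<in> S \<Longrightarrow> \<bar>real k - y\<bar> \<le> 2 * be * real n) \<Longrightarrow>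
         (\<Sum>k\<in>S. (real n powr (1 / 3) + \<bar>real k - y\<bar>) powr (- (q / 4))) \<le> E) \<Longrightarrow>
      (\<Sum>k<N. cmod (coef n k) powr q) \<le> C * (real n powr (- (q / 4)) * E + real n powr (1 - q))"
    using coef_power_sum_le[OF q] by blast
  have L: "1 \<le> real n powr (1 / 3)" if "1 \<le> n" for n :: nat
    using that by (auto intro!: ge_one_powr_ge_zero)
  have R: "real n powr (1 / 3) + 2 * be * real n + 1 \<le> (2 * be + 2) * real n" if "1 \<le> n" for n :: nat
  proof -
    have "real n powr (1 / 3) \<le> real n powr 1" using that by (intro powr_mono) auto
    then show ?thesis using that by (simp add: algebra_simps)
  qed
  consider "q < 4" | "q = 4" | "4 < q" by linarith
  then show thesis
  proof cases
    case 1
    define D where "D = 4 / (1 - q / 4) * (2 * be + 2) powr (1 - q / 4)"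
    have D: "0 < D" using 1 constants_pos by (simp add: D_def)
    show thesis
    proof (rule that)
      show "0 < C * (D + 1)" using C D by simp
      fix n N :: nat assume n: "1 \<le> n"
      have "(\<Sum>k<N. cmod (coef n k) powr q) \<le> C * (real n powr (- (q / 4)) * (D * real n powr (1 - q / 4)) + real n powr (1 - q))"
      proof (rule le)
        fix y S assume S: "finite S" "\<And>k. k \<in> S \<Longrightarrow> \<bar>real k - y\<bar> \<le> 2 * be * real n"
        have "(\<Sum>k\<in>S. (real n powr (1 / 3) + \<bar>real k - y\<bar>) powr (- (q / 4))) \<le>
            4 / (1 - q / 4) * (real n powr (1 / 3) + 2 * be * real n + 1) powr (1 - q / 4)"
          using 1 q L[OF n] S constants_pos by (intro sum_dist_powr_small_exponent) auto
        also have "\<dots> \<le> 4 / (1 - q / 4) * ((2 * be + 2) * real n) powr (1 - q / 4)"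
          using 1 R[OF n] constants_pos by (intro mult_left_mono powr_mono2) auto
        also have "\<dots> = D * real n powr (1 - q / 4)"
          by (simp add: D_def powr_mult)
        finally show "(\<Sum>k\<in>S. (real n powr (1 / 3) + \<bar>real k - y\<bar>) powr (- (q / 4))) \<le> D * real n powr (1 - q / 4)" .
      qed (use n in simp)
      also have "real n powr (- (q / 4)) * (D * real n powr (1 - q / 4)) = D * real n powr (1 - q / 2)"
        by (simp flip: powr_add)
      also have "real n powr (1 - q) \<le> real n powr (1 - q / 2)"
        using n q by (intro powr_mono) auto
      finally show "(\<Sum>k<N. cmod (coef n k) powr q) \<le> C * (D + 1) * power_sum_rate q n"
        using C 1 by (simp add: power_sum_rate_def algebra_simps)
    qed
  next
    case 2
    define D where "D = 4 * (ln (2 * be + 2) / ln 2 + 1)"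
    have D: "0 < D" using constants_pos by (auto simp: D_def intro!: add_nonneg_pos divide_nonneg_nonneg ln_ge_zero)
    show thesis
    proof (rule that)
      show "0 < C * (D + 1 / ln 2)" using C D by (simp add: add_pos_pos)
      fix n N :: nat assume n: "1 \<le> n" "q = 4 \<Longrightarrow> 2 \<le> n"
      then have n2: "2 \<le> n" using 2 by simp
      \<comment> \<open>n \<ge> 2 lets additive constants be absorbed into multiples of ln n; at n =
        1 the rate is 0.\<close>
      have ln2: "ln 2 \<le> ln (real n)" using n2 by simp
      then have lnn: "1 \<le> ln (real n) / ln 2" by simp
      have "(\<Sum>k<N. cmod (coef n k) powr q) \<le> C * (real n powr (- (q / 4)) * (D * ln (real n)) + real n powr (1 - q))"
      proof (rule le)
        fix y S assume S: "finite S" "\<And>k. k \<in> S \<Longrightarrow> \<bar>real k - y\<bar> \<le> 2 * be * real n"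
        have "(\<Sum>k\<in>S. (real n powr (1 / 3) + \<bar>real k - y\<bar>) powr (- (q / 4))) \<le>
            4 * ln (real n powr (1 / 3) + 2 * be * real n + 1)"
          using sum_dist_inverse[OF L[OF n(1)] S] 2 constants_pos by simp
        also have "\<dots> \<le> 4 * ln ((2 * be + 2) * real n)"
        proof (intro mult_left_mono ln_mono)
          have "0 \<le> 2 * be * real n" using constants_pos by simp
          then show "0 < real n powr (1 / 3) + 2 * be * real n + 1" using L[OF n(1)] by linarith
        qed (use R[OF n(1)] in auto)
        also have "\<dots> = 4 * (ln (2 * be + 2) * 1 + ln (real n))"
          using n2 constants_pos by (simp add: ln_mult)
        also have "\<dots> \<le> 4 * (ln (2 * be + 2) * (ln (real n) / ln 2) + ln (real n))"
          using lnn constants_pos by (intro mult_left_mono add_mono) auto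
        also have "\<dots> = D * ln (real n)" by (simp add: D_def algebra_simps)
        finally show "(\<Sum>k\<in>S. (real n powr (1 / 3) + \<bar>real k - y\<bar>) powr (- (q / 4))) \<le> D * ln (real n)" .
      qed (use n in simp)
      also have "real n powr (- (q / 4)) * (D * ln (real n)) = D * (ln (real n) / real n)"
        using 2 n by (simp add: powr_minus_divide)
      also have "real n powr (1 - q) \<le> (1 / ln 2) * (ln (real n) / real n)"
      proof -
        have "real n powr (1 - q) \<le> real n powr (- 1)" using n 2 by (intro powr_mono) auto
        also have "\<dots> = 1 * (1 / real n)" using n by (simp add: powr_minus_divide)
        also have "\<dots> \<le> (ln (real n) / ln 2) * (1 / real n)" using lnn by (intro mult_right_mono) auto
        finally show ?thesis by simp
      qed
      finally show "(\<Sum>k<N. cmod (coef n k) powr q) \<le> C * (D + 1 / ln 2) * power_sum_rate q n"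
        using C 2 by (simp add: power_sum_rate_def distrib_left distrib_right mult.assoc add_divide_distrib)
    qed
  next
    case 3
    define D where "D = 2 * 2 powr (q / 4) / (q / 4 - 1)"
    have D: "0 < D" using 3 by (simp add: D_def)
    show thesis
    proof (rule that)
      show "0 < C * (D + 1)" using C D by simp
      fix n N :: nat assume n: "1 \<le> n"
      have "(\<Sum>k<N. cmod (coef n k) powr q) \<le> C * (real n powr (- (q / 4)) * (D * (real n powr (1 / 3)) powr (1 - q / 4)) + real n powr (1 - q))"
        by (rule le) (use n 3 L[OF n] in \<open>auto simp: D_def intro!: sum_dist_powr_large_exponent[THEN order_trans]\<close>)
      also have "real n powr (- (q / 4)) * (D * (real n powr (1 / 3)) powr (1 - q / 4)) = D * real n powr (- (q / 4) + 1 / 3 * (1 - q / 4))"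
        by (simp add: powr_powr flip: powr_add)
      also have "- (q / 4) + 1 / 3 * (1 - q / 4) = (1 - q) / 3" by (simp add: field_simps)
      also have "real n powr (1 - q) \<le> real n powr ((1 - q) / 3)"
        using n q by (intro powr_mono) auto
      finally show "(\<Sum>k<N. cmod (coef n k) powr q) \<le> C * (D + 1) * power_sum_rate q n"
        using C 3 by (simp add: power_sum_rate_def algebra_simps)
    qed
  qed
qed

text \<open>Jensen on at most 12 * m indices: the mass m powr (3/4) * n powr (-1/4) to the power q,
  times (12 * m) powr (1 - q).\<close>

lemma annulus_power_sum:
  assumes q: "1 < q"
  obtains A \<eta> c where "1 < A" "0 < \<eta>" "0 < c"
    and "\<And>n m. 0 < n \<Longrightarrow> A * real n powr (1 / 3) \<le> m \<Longrightarrow> m \<le> \<eta> * real n \<Longrightarrow>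
      c * m powr (1 - q / 4) * real n powr (- (q / 4)) \<le> (\<Sum>k\<in>annulus n (m / A) m. cmod (coef n k) powr q)"
proof -
  obtain A \<eta> c where A: "1 < A" "0 < \<eta>" "0 < c"
    and mass: "\<And>n m. 0 < n \<Longrightarrow> A * real n powr (1 / 3) \<le> m \<Longrightarrow> m \<le> \<eta> * real n \<Longrightarrow>
           c * m powr (3 / 4) * real n powr (- 1 / 4) \<le> (\<Sum>k\<in>annulus n (m / A) m. cmod (coef n k))"
    using annulus_mass by blast
  show thesis
  proof (rule that[OF A(1,2)])
    show "0 < 12 powr (1 - q) * c powr q" using A by simp
    fix n m assume *: "0 < n" "A * real n powr (1 / 3) \<le> m" "m \<le> \<eta> * real n"
    have "A * 1 \<le> A * real n powr (1 / 3)" using A * by (intro mult_left_mono ge_one_powr_ge_zero) auto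
    then have m: "1 \<le> m" using * A by linarith
    have e: "m powr (1 - q) * m powr (3 / 4 * q) = m powr (1 - q / 4)"
      by (simp flip: powr_add)
    have "12 powr (1 - q) * c powr q * m powr (1 - q / 4) * real n powr (- (q / 4)) =
        (12 * m) powr (1 - q) * (c * m powr (3 / 4) * real n powr (- 1 / 4)) powr q"
      by (simp add: powr_mult powr_powr e[symmetric] mult_ac)
    also have "\<dots> \<le> (12 * m) powr (1 - q) * (\<Sum>k\<in>annulus n (m / A) m. cmod (coef n k)) powr q"
      using mass[OF *] A q by (intro mult_left_mono powr_mono2) auto
    also have "\<dots> \<le> (\<Sum>k\<in>annulus n (m / A) m. cmod (coef n k) powr q)"
      using m q by (intro sum_powr_ge_powr_sum finite_annulus card_annulus) auto
    finally show "12 powr (1 - q) * c powr q * m powr (1 - q / 4) * real n powr (- (q / 4)) \<le>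
        (\<Sum>k\<in>annulus n (m / A) m. cmod (coef n k) powr q)" .
  qed
qed

text \<open>For large n all radii from \<eta> * n powr (2/3) to \<eta> * n are admissible. A full
  power of n between them is what leaves room for logarithmically many annuli when q = 4.\<close>

lemma eventually_scale:
  assumes "0 < \<eta>"
  shows "eventually (\<lambda>n. 0 < n \<and> A * real n powr (1 / 3) \<le> \<eta> * real n powr (2 / 3)) sequentially"
proof -
  have "eventually (\<lambda>n. \<bar>A / \<eta>\<bar> ^ 3 \<le> real n) sequentially"
    using eventually_ge_at_top[of "nat \<lceil>\<bar>A / \<eta>\<bar> ^ 3\<rceil>"] by (rule eventually_mono) linarith
  then have "eventually (\<lambda>n. A / \<eta> \<le> real n powr (1 / 3)) sequentially"
  proof eventually_elim
    case (elim n)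
    have "A / \<eta> \<le> \<bar>A / \<eta>\<bar>" by (rule abs_ge_self)
    also have "\<dots> = (\<bar>A / \<eta>\<bar> ^ 3) powr (1 / 3)" by (cases "A = 0 \<or> \<eta> = 0") (auto simp: powr_powr simp flip: powr_numeral)
    also have "\<dots> \<le> real n powr (1 / 3)" using elim by (intro powr_mono2) auto
    finally show ?case .
  qed
  then show ?thesis using eventually_gt_at_top[of 0]
  proof eventually_elim
    case (elim n)
    then have "A * real n powr (1 / 3) \<le> \<eta> * real n powr (1 / 3) * real n powr (1 / 3)"
      using assms by (intro mult_right_mono) (auto simp: field_simps)
    also have "\<dots> = \<eta> * real n powr (2 / 3)" by (simp add: mult.assoc flip: powr_add)
    finally show ?case using elim by simp
  qed
qed

text \<open>
  For q < 4 the mass sits in the annulus of radius comparable to n, for q > 4 in the one of radius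
  comparable to n powr (1/3), and for q = 4 each of the roughly ln n geometric annuli in between
  contributes equally.
\<close>

lemma coef_power_sum_lower:
  assumes q: "1 < q"
  obtains c N where "0 < c"
    and "\<And>n. N \<le> n \<Longrightarrow> \<exists>K. finite K \<and> c * power_sum_rate q n \<le> (\<Sum>k\<in>K. cmod (coef n k) powr q)"
proof -
  obtain A \<eta> c where A: "1 < A" "0 < \<eta>" "0 < c"
    and mass: "\<And>n m. 0 < n \<Longrightarrow> A * real n powr (1 / 3) \<le> m \<Longrightarrow> m \<le> \<eta> * real n \<Longrightarrow>
      c * m powr (1 - q / 4) * real n powr (- (q / 4)) \<le> (\<Sum>k\<in>annulus n (m / A) m. cmod (coef n k) powr q)"
    using annulus_power_sum[OF q] by blast
  obtain N where N: "\<And>n. N \<le> n \<Longrightarrow> 0 < n \<and> A * real n powr (1 / 3) \<le> \<eta> * real n powr (2 / 3)"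
    using eventually_scale[OF A(2), of A] by (auto simp: eventually_sequentially)
  have top: "0 < n" "A * real n powr (1 / 3) \<le> \<eta> * real n" if "N \<le> n" for n
  proof -
    show "0 < n" using N[OF that] by simp
    then have "\<eta> * real n powr (2 / 3) \<le> \<eta> * real n powr 1" using A by (intro mult_left_mono powr_mono) auto
    then show "A * real n powr (1 / 3) \<le> \<eta> * real n" using N[OF that] by simp
  qed
  consider "q < 4" | "q = 4" | "4 < q" by linarith
  then show thesis
  proof cases
    case 1
    show thesis
    proof (rule that)
      show "0 < c * \<eta> powr (1 - q / 4)" using A by simp
      fix n assume n: "N \<le> n"
      have "c * \<eta> powr (1 - q / 4) * power_sum_rate q n = c * (\<eta> * real n) powr (1 - q / 4) * real n powr (- (q / 4))"
        using 1 by (simp add: power_sum_rate_def powr_mult mult_ac flip: powr_add)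
      also have "\<dots> \<le> (\<Sum>k\<in>annulus n (\<eta> * real n / A) (\<eta> * real n). cmod (coef n k) powr q)"
        by (rule mass) (use top[OF n] in auto)
      finally show "\<exists>K. finite K \<and> c * \<eta> powr (1 - q / 4) * power_sum_rate q n \<le> (\<Sum>k\<in>K. cmod (coef n k) powr q)"
        using finite_annulus by blast
    qed
  next
    case 2
    show thesis
    proof (rule that)
      show "0 < c / (3 * ln A)" using A by simp
      fix n assume n: "N \<le> n"
      \<comment> \<open>i < I means A ^ i < n powr (1/3), which keeps the radii \<eta> * n / A ^ i
        above \<eta> * n powr (2/3).\<close>
      define I where "I = nat \<lceil>ln (real n) / (3 * ln A)\<rceil>"
      define m where "m i = \<eta> * real n / A ^ i" for i
      have n0: "0 < n" using top[OF n] by simp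
      \<comment> \<open>At q = 4 the exponent 1 - q / 4 vanishes, so the bound does not depend on
        the radius.\<close>
      have mass': "c / real n \<le> (\<Sum>k\<in>annulus n (m (Suc i)) (m i). cmod (coef n k) powr q)" if i: "i < I" for i
      proof -
        have "real i < ln (real n) / (3 * ln A)" using i by (simp add: I_def) linarith
        then have "real i * ln A \<le> 1 / 3 * ln (real n)" using A by (simp add: field_simps)
        then have "ln (A ^ i) \<le> ln (real n powr (1 / 3))" using A n0 by (simp add: ln_realpow ln_powr)
        then have Ai: "A ^ i \<le> real n powr (1 / 3)" using A n0 by (subst (asm) ln_le_cancel_iff) auto
        have "\<eta> * real n powr (2 / 3) * A ^ i \<le> \<eta> * real n powr (2 / 3) * real n powr (1 / 3)"
          using Ai A by (intro mult_left_mono) auto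
        also have "\<dots> = \<eta> * real n" using n0 by (simp add: mult.assoc flip: powr_add)
        finally have "\<eta> * real n powr (2 / 3) \<le> m i" using A by (simp add: m_def field_simps)
        then have lower: "A * real n powr (1 / 3) \<le> m i" using N[OF n] by linarith
        have "\<eta> * real n / A ^ i \<le> \<eta> * real n / 1"
          using A by (intro divide_left_mono) (auto intro: one_le_power)
        then have upper: "m i \<le> \<eta> * real n" by (simp add: m_def)
        have pos: "0 < m i" using A n0 by (simp add: m_def)
        have "m i / A = m (Suc i)" by (simp add: m_def mult.commute)
        then show ?thesis
          using mass[OF n0 lower upper] 2 pos by (simp add: powr_minus_divide)
      qed
      have disj: "annulus n (m (Suc i)) (m i) \<inter> annulus n (m (Suc j)) (m j) = {}" if "i < j" for i j
      proof -
        have "m j \<le> m (Suc i)"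
          unfolding m_def using A that by (intro divide_left_mono power_increasing) auto
        then show ?thesis by (auto simp: annulus_def)
      qed
      have "ln (real n) / (3 * ln A) \<le> real I" by (simp add: I_def) linarith
      then have "ln (real n) / (3 * ln A) * (c / real n) \<le> real I * (c / real n)"
        using A by (intro mult_right_mono) auto
      also have "\<dots> = (\<Sum>i<I. c / real n)" by simp
      also have "\<dots> \<le> (\<Sum>i<I. \<Sum>k\<in>annulus n (m (Suc i)) (m i). cmod (coef n k) powr q)"
        by (intro sum_mono mass') auto
      also have "\<dots> = (\<Sum>k\<in>(\<Union>i<I. annulus n (m (Suc i)) (m i)). cmod (coef n k) powr q)"
      proof (rule sum.UNION_disjoint[symmetric])
        show "\<forall>i\<in>{..<I}. \<forall>j\<in>{..<I}. i \<noteq> j \<longrightarrow> annulus n (m (Suc i)) (m i) \<inter> annulus n (m (Suc j)) (m j) = {}"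
          using disj by (metis Int_commute linorder_neqE_nat)
      qed (auto simp: finite_annulus)
      finally have "c / (3 * ln A) * power_sum_rate q n \<le> (\<Sum>k\<in>(\<Union>i<I. annulus n (m (Suc i)) (m i)). cmod (coef n k) powr q)"
        using 2 by (simp add: power_sum_rate_def mult.commute)
      moreover have "finite (\<Union>i<I. annulus n (m (Suc i)) (m i))" by (simp add: finite_annulus)
      ultimately show "\<exists>K. finite K \<and> c / (3 * ln A) * power_sum_rate q n \<le> (\<Sum>k\<in>K. cmod (coef n k) powr q)"
        by blast
    qed
  next
    case 3
    show thesis
    proof (rule that)
      show "0 < c * A powr (1 - q / 4)" using A by simp
      fix n assume n: "N \<le> n"
      have "(1 - q) / 3 = 1 / 3 * (1 - q / 4) + - (q / 4)" by (simp add: field_simps)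
      then have "power_sum_rate q n = (real n powr (1 / 3)) powr (1 - q / 4) * real n powr (- (q / 4))"
        using 3 by (simp only: power_sum_rate_def powr_add powr_powr) simp
      then have "c * A powr (1 - q / 4) * power_sum_rate q n = c * (A * real n powr (1 / 3)) powr (1 - q / 4) * real n powr (- (q / 4))"
        by (simp add: powr_mult mult_ac)
      also have "\<dots> \<le> (\<Sum>k\<in>annulus n (A * real n powr (1 / 3) / A) (A * real n powr (1 / 3)). cmod (coef n k) powr q)"
        by (rule mass) (use top[OF n] in auto)
      finally show "\<exists>K. finite K \<and> c * A powr (1 - q / 4) * power_sum_rate q n \<le> (\<Sum>k\<in>K. cmod (coef n k) powr q)"
        using finite_annulus by blast
    qed
  qed
qed

text \<open>Pigeonhole in place of Jensen: at m = A * n powr (1/3) the mass is at least a constant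
  and is spread over at most 12 * m indices, so some coefficient has order at least 1 / m.\<close>

lemma coef_sup_lower:
  obtains c N where "0 < c"
    and "\<And>n. N \<le> n \<Longrightarrow> \<exists>k. c * real n powr (- 1 / 3) \<le> cmod (coef n k)"
proof -
  obtain A \<eta> c where A: "1 < A" "0 < \<eta>" "0 < c"
    and mass: "\<And>n m. 0 < n \<Longrightarrow> A * real n powr (1 / 3) \<le> m \<Longrightarrow> m \<le> \<eta> * real n \<Longrightarrow>
           c * m powr (3 / 4) * real n powr (- 1 / 4) \<le> (\<Sum>k\<in>annulus n (m / A) m. cmod (coef n k))"
    using annulus_mass by blast
  obtain N where N: "\<And>n. N \<le> n \<Longrightarrow> 0 < n \<and> A * real n powr (1 / 3) \<le> \<eta> * real n powr (2 / 3)"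
    using eventually_scale[OF A(2), of A] by (auto simp: eventually_sequentially)
  \<comment> \<open>24 is twice the 12 of \<open>card_annulus\<close>; the spare factor 2 makes the
    contradiction strict.\<close>
  define d where "d = c * A powr (3 / 4) / (24 * A)"
  have d: "0 < d" using A by (simp add: d_def)
  show thesis
  proof (rule that[OF d])
    fix n assume n: "N \<le> n"
    have n0: "0 < n" using N[OF n] by simp
    have "\<eta> * real n powr (2 / 3) \<le> \<eta> * real n powr 1" using A n0 by (intro mult_left_mono powr_mono) auto
    then have up: "A * real n powr (1 / 3) \<le> \<eta> * real n" using N[OF n] by simp
    define m where "m = A * real n powr (1 / 3)"
    have "A * 1 \<le> m" unfolding m_def using A n0 by (intro mult_left_mono ge_one_powr_ge_zero) auto
    then have m: "1 \<le> m" using A by linarith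
    define S where "S = annulus n (m / A) m"
    show "\<exists>k. d * real n powr (- 1 / 3) \<le> cmod (coef n k)"
    proof (rule ccontr)
      assume "\<not> (\<exists>k. d * real n powr (- 1 / 3) \<le> cmod (coef n k))"
      then have "cmod (coef n k) \<le> d * real n powr (- 1 / 3)" for k by (meson less_imp_le not_le)
      then have "(\<Sum>k\<in>S. cmod (coef n k)) \<le> real (card S) * (d * real n powr (- 1 / 3))"
        by (intro sum_bounded_above)
      also have "\<dots> \<le> 12 * m * (d * real n powr (- 1 / 3))"
        unfolding S_def using m d by (intro mult_right_mono card_annulus) auto
      also have "\<dots> = c * A powr (3 / 4) / 2"
        using A n0 by (simp add: m_def d_def powr_minus_divide)
      also have "\<dots> < c * A powr (3 / 4)" using A by simp
      also have "\<dots> = c * m powr (3 / 4) * real n powr (- 1 / 4)"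
        using n0 by (simp add: m_def powr_mult powr_powr powr_minus_divide)
      also have "\<dots> \<le> (\<Sum>k\<in>S. cmod (coef n k))"
        unfolding S_def by (rule mass) (use n0 up in \<open>auto simp: m_def\<close>)
      finally show False by simp
    qed
  qed
qed

section \<open>Small n and the passage to norms\<close>

lemma coef_0: "cmod (coef n 0) = lam ^ n"
  using lam_pos by (simp add: taylor_coeff_def fps_expansion_def blaschke_def norm_power)

lemma lpA_norm_ge_coef:
  assumes "1 < p"
  shows "ennreal (cmod (coef n k)) \<le> lpA_norm p (\<lambda>z. blaschke lam z ^ n)"
proof (cases "p = \<infinity>")
  case True
  then show ?thesis
    unfolding lpA_norm_def by (simp only: simp_thms if_True) (rule SUP_upper, simp)
next
  case False
  define q where "q = enn2real p"
  have "ennreal 1 < ennreal q" using False assms by (simp add: q_def less_top)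
  then have q: "1 < q" by (simp add: ennreal_less_iff)
  have "ennreal ((cmod (coef n k) powr q) powr (1 / q)) \<le> lpA_norm p (\<lambda>z. blaschke lam z ^ n)"
    by (rule lpA_norm_ge[where K = "{k}"])
      (use assms False in \<open>auto simp: q_def less_top intro: less_trans[OF zero_less_one]\<close>)
  then show ?thesis using q by (simp add: powr_powr)
qed

text \<open>The finitely many n < N are covered by the zeroth coefficient: the norm is at least lam
  ^ n \<ge> lam ^ N, while \<open>Psi\<close> is at most \<open>M\<close> there.\<close>

lemma lower_bound_from_tail:
  assumes p: "1 < p" and c: "0 < c"
    and tail: "\<And>n. N \<le> n \<Longrightarrow> ennreal (c * Psi p n) \<le> lpA_norm p (\<lambda>z. blaschke lam z ^ n)"
  obtains d where "0 < d" "\<And>n. ennreal (d * Psi p n) \<le> lpA_norm p (\<lambda>z. blaschke lam z ^ n)"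
proof -
  have Psi: "0 \<le> Psi p n" for n by (simp add: Psi_def)
  define M where "M = 1 + (\<Sum>i<N. Psi p i)"
  have M: "0 < M" using Psi by (simp add: M_def sum_nonneg add_pos_nonneg)
  define d where "d = min c (lam ^ N / M)"
  show thesis
  proof
    show "0 < d" using c M lam_pos by (simp add: d_def)
    fix n
    show "ennreal (d * Psi p n) \<le> lpA_norm p (\<lambda>z. blaschke lam z ^ n)"
    proof (cases "N \<le> n")
      case True
      have "d * Psi p n \<le> c * Psi p n" using Psi by (intro mult_right_mono) (auto simp: d_def)
      then show ?thesis using tail[OF True] by (meson ennreal_leI order_trans)
    next
      case False
      then have "Psi p n \<le> (\<Sum>i<N. Psi p i)" using Psi by (intro member_le_sum) auto
      then have "Psi p n \<le> M" by (simp add: M_def)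
      then have "d * Psi p n \<le> lam ^ N / M * M"
        using Psi M lam_pos by (intro mult_mono) (auto simp: d_def)
      also have "\<dots> = lam ^ N" using M by simp
      also have "\<dots> \<le> lam ^ n" using False lam_pos lam_less_1 by (intro power_decreasing) auto
      finally show ?thesis
        using lpA_norm_ge_coef[OF p, of n 0] by (simp add: coef_0) (meson ennreal_leI order_trans)
    qed
  qed
qed

lemma bounds_finite:
  assumes p: "1 < p" "p < \<infinity>"
  obtains c C N where "0 < c" "0 < C"
    and "\<And>n. N \<le> n \<Longrightarrow> ennreal (c * Psi p n) \<le> lpA_norm p (\<lambda>z. blaschke lam z ^ n)"
    and "\<And>n. 1 \<le> n \<Longrightarrow> (p = 4 \<Longrightarrow> 2 \<le> n) \<Longrightarrow> lpA_norm p (\<lambda>z. blaschke lam z ^ n) \<le> ennreal (C * Psi p n)"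
proof -
  define q where "q = enn2real p"
  have pq: "p = ennreal q" using p(2) by (simp add: q_def)
  have "ennreal 1 < ennreal q" using p(1) pq by simp
  then have q: "1 < q" by (simp add: ennreal_less_iff)
  have p0: "0 < p" using p(1) by (rule less_trans[OF zero_less_one])
  have p4: "p = 4" if "q = 4" using that pq by simp
  have Psi: "Psi p n = power_sum_rate q n powr (1 / q)" for n
    unfolding pq using q by (intro Psi_finite) simp
  obtain C where C: "0 < C" and upper: "\<And>n N. 1 \<le> n \<Longrightarrow> (q = 4 \<Longrightarrow> 2 \<le> n) \<Longrightarrow>
      (\<Sum>k<N. cmod (coef n k) powr q) \<le> C * power_sum_rate q n"
    using coef_power_sum_upper[OF q] by blast
  obtain c N where c: "0 < c" and lower: "\<And>n. N \<le> n \<Longrightarrow>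
      \<exists>K. finite K \<and> c * power_sum_rate q n \<le> (\<Sum>k\<in>K. cmod (coef n k) powr q)"
    using coef_power_sum_lower[OF q] by blast
  show thesis
  proof (rule that)
    show "0 < c powr (1 / q)" "0 < C powr (1 / q)" using c C by auto
    show "lpA_norm p (\<lambda>z. blaschke lam z ^ n) \<le> ennreal (C powr (1 / q) * Psi p n)"
      if "1 \<le> n" "p = 4 \<Longrightarrow> 2 \<le> n" for n
      using lpA_norm_le[OF p0 p(2) q_def upper] that p4 by (simp add: Psi powr_mult)
    show "ennreal (c powr (1 / q) * Psi p n) \<le> lpA_norm p (\<lambda>z. blaschke lam z ^ n)" if n: "N \<le> n" for n
    proof -
      obtain K where K: "finite K" "c * power_sum_rate q n \<le> (\<Sum>k\<in>K. cmod (coef n k) powr q)"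
        using lower[OF n] by blast
      have "0 \<le> c * power_sum_rate q n" using c power_sum_rate_nonneg by simp
      from lpA_norm_ge[OF p0 p(2) q_def K(1) this K(2)] show ?thesis
        by (simp add: Psi powr_mult)
    qed
  qed
qed

lemma bounds_infinite:
  obtains c C N where "0 < c" "0 < C"
    and "\<And>n. N \<le> n \<Longrightarrow> ennreal (c * Psi \<infinity> n) \<le> lpA_norm \<infinity> (\<lambda>z. blaschke lam z ^ n)"
    and "\<And>n. 1 \<le> n \<Longrightarrow> lpA_norm \<infinity> (\<lambda>z. blaschke lam z ^ n) \<le> ennreal (C * Psi \<infinity> n)"
proof -
  obtain c N where c: "0 < c" and lower: "\<And>n. N \<le> n \<Longrightarrow> \<exists>k. c * real n powr (- 1 / 3) \<le> cmod (coef n k)"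
    using coef_sup_lower by blast
  show thesis
  proof (rule that[OF c])
    show "0 < 2 + 10 / sqrt (slope / 2)" using constants_pos by (auto intro!: add_pos_nonneg)
    show "lpA_norm \<infinity> (\<lambda>z. blaschke lam z ^ n) \<le> ennreal ((2 + 10 / sqrt (slope / 2)) * Psi \<infinity> n)" if "1 \<le> n" for n
    proof -
      have "cmod (coef n k) \<le> (2 + 10 / sqrt (slope / 2)) * real n powr (- 1 / 3)" for k
        using coef_le_osc[of n k] osc_bound_uniform[of n pi k] that by simp
      then show ?thesis
        unfolding Psi_infinity lpA_norm_def by (simp only: simp_thms if_True) (intro SUP_least ennreal_leI, simp)
    qed
    show "ennreal (c * Psi \<infinity> n) \<le> lpA_norm \<infinity> (\<lambda>z. blaschke lam z ^ n)" if n: "N \<le> n" for n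
    proof -
      obtain k where "c * Psi \<infinity> n \<le> cmod (coef n k)" using lower[OF n] unfolding Psi_infinity by blast
      then have "ennreal (c * Psi \<infinity> n) \<le> ennreal (cmod (coef n k))" by (rule ennreal_leI)
      also have "\<dots> \<le> lpA_norm \<infinity> (\<lambda>z. blaschke lam z ^ n)" by (rule lpA_norm_ge_coef) simp
      finally show ?thesis .
    qed
  qed
qed

end

theorem theorem1:
  fixes lam :: real and p :: ennreal
  assumes "0 < lam" and "lam < 1" and "1 < p"
  shows "\<exists>c C :: real. c > 0 \<and> C > 0 \<and>
           (\<forall>n::nat. n \<ge> 1 \<and> (p = 4 \<longrightarrow> n \<ge> 2) \<longrightarrow>
              ennreal (c * Psi p n) \<le> lpA_norm p (\<lambda>z. blaschke lam z ^ n) \<and>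
              lpA_norm p (\<lambda>z. blaschke lam z ^ n) \<le> ennreal (C * Psi p n))"
proof -
  interpret blaschke_factor lam
    using assms by unfold_locales
  obtain c C N where c: "0 < c" "0 < C"
    and lower: "\<And>n. N \<le> n \<Longrightarrow> ennreal (c * Psi p n) \<le> lpA_norm p (\<lambda>z. blaschke lam z ^ n)"
    and upper: "\<And>n. 1 \<le> n \<Longrightarrow> (p = 4 \<Longrightarrow> 2 \<le> n) \<Longrightarrow>
      lpA_norm p (\<lambda>z. blaschke lam z ^ n) \<le> ennreal (C * Psi p n)"
  proof (cases "p = \<infinity>")
    case True
    then show thesis using bounds_infinite that by metis
  next
    case False
    then have "p < \<infinity>" by (simp add: less_top)
    then show thesis using bounds_finite[OF assms(3)] that by metis
  qed
  obtain d where "0 < d" "\<And>n. ennreal (d * Psi p n) \<le> lpA_norm p (\<lambda>z. blaschke lam z ^ n)"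
    using lower_bound_from_tail[OF assms(3) c(1) lower] by blast
  then show ?thesis using c(2) upper by blast
qed

end
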